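(* There is a nonempty $\Pi^0_1$ class $\mathcal P\subseteq 2^\omega$ with no computable members such that every member of $\mathcal P$ is BLR traceable.
   Context: An order function is a computable nondecreasing unbounded function. A function is $\omega$-c.e. by $A$ if it equals $\lim_t\Gamma^A(x,t)$ for an $A$-computable $\Gamma^A$ whose number of changes at $x$ is bounded by a computable function of $x$. A BLR trace is a sequence $(T_n)$ with $T_n=W_{r(n)}$ where $r(n)=\lim_t g(n,t)$ for a computable $g$ whose number of changes is computably bounded; it has bound $h$ if $|T_n|\le h(n)$. $A$ is BLR traceable if for some order function $h$, every function $f$ that is $\omega$-c.e. by $A$ has a BLR trace $(T_n)$ with bound $h$ and $f(n)\in T_n$ for all $n$. *)

theory Defs
  imports Main "HOL-Library.Nat_Bijection"
begin

datatype rf = Zero | Succ | Proj nat | Comp rf "rf list" | Prec rf rf | Mu rf | Orc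

inductive ev :: "nat set \<Rightarrow> rf \<Rightarrow> nat list \<Rightarrow> nat \<Rightarrow> bool" for A :: "nat set" where
  ev_Zero: "ev A Zero xs 0"
| ev_Succ: "ev A Succ (x # xs) (Suc x)"
| ev_Proj: "i < length xs \<Longrightarrow> ev A (Proj i) xs (xs ! i)"
| ev_Comp: "list_all2 (\<lambda>g y. ev A g xs y) gs ys \<Longrightarrow> ev A f ys z \<Longrightarrow> ev A (Comp f gs) xs z"
| ev_Prec0: "ev A f xs y \<Longrightarrow> ev A (Prec f g) (0 # xs) y"
| ev_PrecS: "ev A (Prec f g) (n # xs) y \<Longrightarrow> ev A g (y # n # xs) z \<Longrightarrow> ev A (Prec f g) (Suc n # xs) z"
| ev_Mu: "ev A f (n # xs) 0 \<Longrightarrow> (\<forall>m<n. \<exists>y. ev A f (m # xs) (Suc y)) \<Longrightarrow> ev A (Mu f) xs n"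
| ev_Orc: "ev A Orc (x # xs) (if x \<in> A then 1 else 0)"

fun code :: "rf \<Rightarrow> nat" where
  "code Zero = prod_encode (0, 0)"
| "code Succ = prod_encode (1, 0)"
| "code (Proj i) = prod_encode (2, i)"
| "code (Comp f gs) = prod_encode (3, prod_encode (code f, list_encode (map code gs)))"
| "code (Prec f g) = prod_encode (4, prod_encode (code f, code g))"
| "code (Mu f) = prod_encode (5, code f)"
| "code Orc = prod_encode (6, 0)"

definition comp1_rel :: "nat set \<Rightarrow> (nat \<Rightarrow> nat) \<Rightarrow> bool" where
  "comp1_rel A f \<longleftrightarrow> (\<exists>p. \<forall>x. ev A p [x] (f x))"

definition comp2_rel :: "nat set \<Rightarrow> (nat \<Rightarrow> nat \<Rightarrow> nat) \<Rightarrow> bool" where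
  "comp2_rel A f \<longleftrightarrow> (\<exists>p. \<forall>x t. ev A p [x, t] (f x t))"

abbreviation computable1 :: "(nat \<Rightarrow> nat) \<Rightarrow> bool" where
  "computable1 f \<equiv> comp1_rel {} f"

abbreviation computable2 :: "(nat \<Rightarrow> nat \<Rightarrow> nat) \<Rightarrow> bool" where
  "computable2 f \<equiv> comp2_rel {} f"

definition computable_set :: "nat set \<Rightarrow> bool" where
  "computable_set X \<longleftrightarrow> computable1 (\<lambda>n. if n \<in> X then 1 else 0)"

definition W :: "nat \<Rightarrow> nat set" where
  "W e = {x. \<exists>p y. code p = e \<and> ev {} p [x] y}"

definition init_code :: "nat set \<Rightarrow> nat \<Rightarrow> nat" where
  "init_code X n = list_encode (map (\<lambda>i. if i \<in> X then 1 else 0) [0..<n])"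

text \<open>Pi^0_1 classes in Cantor space (subsets of nat identified with 2^omega).\<close>
definition pi01_class :: "nat set set \<Rightarrow> bool" where
  "pi01_class P \<longleftrightarrow> (\<exists>R. computable1 R \<and> P = {X. \<forall>n. R (init_code X n) = 0})"

definition order_function :: "(nat \<Rightarrow> nat) \<Rightarrow> bool" where
  "order_function h \<longleftrightarrow> computable1 h \<and> mono h \<and> (\<forall>m. \<exists>n. m < h n)"

definition limit_bounded_changes ::
  "(nat \<Rightarrow> nat \<Rightarrow> nat) \<Rightarrow> (nat \<Rightarrow> nat) \<Rightarrow> (nat \<Rightarrow> nat) \<Rightarrow> bool" where
  "limit_bounded_changes g f b \<longleftrightarrow>
     (\<forall>x. (\<exists>s. \<forall>t\<ge>s. g x t = f x)
        \<and> finite {t. g x (Suc t) \<noteq> g x t}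
        \<and> card {t. g x (Suc t) \<noteq> g x t} \<le> b x)"

definition omega_ce_by :: "nat set \<Rightarrow> (nat \<Rightarrow> nat) \<Rightarrow> bool" where
  "omega_ce_by A f \<longleftrightarrow>
     (\<exists>\<Gamma> b. comp2_rel A \<Gamma> \<and> computable1 b \<and> limit_bounded_changes \<Gamma> f b)"

definition BLR_trace :: "(nat \<Rightarrow> nat set) \<Rightarrow> bool" where
  "BLR_trace T \<longleftrightarrow>
     (\<exists>g r b. computable2 g \<and> computable1 b \<and> limit_bounded_changes g r b
        \<and> (\<forall>n. T n = W (r n)))"

definition BLR_traceable :: "nat set \<Rightarrow> bool" where
  "BLR_traceable A \<longleftrightarrow>
     (\<exists>h. order_function h \<and>
        (\<forall>f. omega_ce_by A f \<longrightarrow>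
           (\<exists>T. BLR_trace T \<and> (\<forall>n. finite (T n) \<and> card (T n) \<le> h n) \<and> (\<forall>n. f n \<in> T n))))"

end

theory Submission
  imports Defs "HOL-Library.Sublist"
begin

text \<open>The class consists of the paths through a computable sequence of perfect trees, each a subtree
  of the previous one, whose levels converge. Level m of the tree minds finitely many requirements
  (e, n), where e codes a functional together with a bound on its number of changes. Whenever
  replacing the node at \<rho> by one of its extensions would reveal more of the approximations to the
  values that the level of \<rho> minds, the tree moves there; as the number of changes is bounded, this
  is a finite injury process. In the limit the nodes of that level decide the value at n of the
  functional e for all paths above them, so the at most 2^n values found at these nodes form a
  trace. A potential in positional notation bounds the number of changes of this trace by a
  computable function: a level that moves injures only higher levels, and the level which decides
  (e, n) can only fall.

  No path X is computable: otherwise the functional that compares its oracle with X bit by bit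
  outputs only 0 at X but also 1 at every other path, whereas some node on X is such that no path
  above it reveals more of the outputs than the node does.\<close>

section \<open>Computable functions on encoded data\<close>

text \<open>The obstacle is that the bound on the changes of the trace must be computable. Level n
  is injured by every lower level m, and m may take up new requirements long after (e, n) has
  awoken, at a time that cannot be computed. This is why a level that takes up anything takes up all
  that is awake: such a late level m then also minds (e, n), so the nodes of level m decide it from
  then on. This level is the \<open>home\<close> of (e, n). Below its home every level minds exactly
  what it minded when (e, n) awoke. If that was at stage \<open>s0\<close>, at most
  \<open>s0\<close> + 1 requirements with at most \<open>s0\<close> values each are involved, and
  \<open>s0\<close> can be found by search. The home never exceeds n, whence the bound 2^n on the
  trace. Since level n answers only to wake-ups of (e, n) with e \<le> n, the finitely many values
  at n < e are put into the trace by hand. The lists of values are cut off at the declared bound, so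
  progress is bounded for every program, even for one that changes more often than declared. The
  functional that refutes computable members is of this kind: its declared bound is 1.\<close>

lemma ev_Comp1: "ev A g xs y \<Longrightarrow> ev A f [y] z \<Longrightarrow> ev A (Comp f [g]) xs z"
  by (rule ev_Comp[where ys = "[y]"]) auto

lemma ev_Comp2:
  "ev A g xs y \<Longrightarrow> ev A g' xs y' \<Longrightarrow> ev A f [y, y'] z \<Longrightarrow> ev A (Comp f [g, g']) xs z"
  by (rule ev_Comp[where ys = "[y, y']"]) auto

lemma ev_Comp3:
  "ev A g xs y \<Longrightarrow> ev A g' xs y' \<Longrightarrow> ev A g'' xs y'' \<Longrightarrow> ev A f [y, y', y''] z
    \<Longrightarrow> ev A (Comp f [g, g', g'']) xs z"
  by (rule ev_Comp[where ys = "[y, y', y'']"]) auto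

lemma ev_Proj_nth: "i < length xs \<Longrightarrow> y = xs ! i \<Longrightarrow> ev A (Proj i) xs y"
  by (simp add: ev_Proj)

lemma ev_Suc: "y = Suc x \<Longrightarrow> ev A Succ [x] y"
  by (simp add: ev_Succ)

fun const_rf :: "nat \<Rightarrow> rf" where
  "const_rf 0 = Zero"
| "const_rf (Suc n) = Comp Succ [const_rf n]"

lemma ev_const: "ev A (const_rf n) xs n"
  by (induction n) (auto intro: ev_Zero ev_Comp1 ev_Succ)

definition add_rf :: rf where
  "add_rf = Prec (Proj 0) (Comp Succ [Proj 0])"

lemma ev_add: "ev A add_rf [m, n] (m + n)"
  unfolding add_rf_def
proof (induction m)
  case 0
  show ?case by (auto intro!: ev_Prec0 ev_Proj_nth)
next
  case (Suc m)
  show ?case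
    by (rule ev_PrecS[OF Suc]) (auto intro!: ev_Comp1 ev_Proj_nth ev_Suc)
qed

definition pred_rf :: rf where
  "pred_rf = Prec Zero (Proj 1)"

lemma ev_pred: "ev A pred_rf [n] (n - 1)"
  unfolding pred_rf_def
proof (induction n)
  case 0
  show ?case by (auto intro!: ev_Prec0 ev_Zero)
next
  case (Suc n)
  show ?case
    by (rule ev_PrecS[OF Suc]) (auto intro!: ev_Proj_nth)
qed

text \<open>\<open>Prec\<close> recurses on the first argument, so the subtrahend has to come
  first.\<close>

definition sub_rf :: rf where
  "sub_rf = Prec (Proj 0) (Comp pred_rf [Proj 0])"

lemma ev_sub: "ev A sub_rf [m, n] (n - m)"
  unfolding sub_rf_def
proof (induction m)
  case 0
  show ?case by (auto intro!: ev_Prec0 ev_Proj_nth)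
next
  case (Suc m)
  have "ev A (Comp pred_rf [Proj 0]) [n - m, m, n] (n - Suc m)"
    using ev_pred[of A "n - m"] by (intro ev_Comp1[of _ _ _ "n - m"]) (auto intro: ev_Proj_nth)
  then show ?case by (rule ev_PrecS[OF Suc])
qed

definition triangle_rf :: rf where
  "triangle_rf = Prec Zero (Comp add_rf [Proj 0, Comp Succ [Proj 1]])"

lemma ev_triangle: "ev A triangle_rf [n] (triangle n)"
  unfolding triangle_rf_def
proof (induction n)
  case 0
  show ?case by (auto intro!: ev_Prec0 ev_Zero)
next
  case (Suc n)
  have "ev A (Comp add_rf [Proj 0, Comp Succ [Proj 1]]) [triangle n, n] (triangle n + Suc n)"
    by (rule ev_Comp2[OF _ ev_Comp1 ev_add]) (auto intro!: ev_Proj_nth ev_Suc)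
  then show ?case
    using ev_PrecS[OF Suc] by simp
qed

definition pair_rf :: rf where
  "pair_rf = Comp add_rf [Comp triangle_rf [add_rf], Proj 0]"

lemma ev_pair: "ev A pair_rf [m, n] (prod_encode (m, n))"
  unfolding pair_rf_def prod_encode_def prod.case
  by (rule ev_Comp2[OF ev_Comp1[OF ev_add ev_triangle] _ ev_add]) (auto intro!: ev_Proj_nth)

text \<open>In the successor case the arguments are the recursive value, the predecessor,
  \<open>a\<close> and \<open>b\<close>; hence \<open>Proj 3\<close> selects
  \<open>b\<close>.\<close>

definition ifz_rf :: rf where
  "ifz_rf = Prec (Proj 0) (Proj 3)"

lemma ev_ifz: "ev A ifz_rf [c, a, b] (if c = 0 then a else b)"
  unfolding ifz_rf_def
proof (induction c)
  case 0
  show ?case by (auto intro!: ev_Prec0 ev_Proj_nth)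
next
  case (Suc c)
  show ?case
    by (rule ev_PrecS[OF Suc]) (auto intro!: ev_Proj_nth)
qed

text \<open>The largest r with \<open>triangle r \<le> n\<close>. As
  \<open>prod_encode (a, b)\<close> is \<open>triangle (a + b) + a\<close>, this recovers a + b. The
  comparison is a difference tested for 0 because that is what \<open>ifz_rf\<close> offers.\<close>

fun triroot :: "nat \<Rightarrow> nat" where
  "triroot 0 = 0"
| "triroot (Suc n) =
    (if triangle (Suc (triroot n)) - Suc n = 0 then Suc (triroot n) else triroot n)"

lemma triroot_bounds: "triangle (triroot n) \<le> n \<and> n < triangle (Suc (triroot n))"
  by (induction n) auto

lemma prod_decode_triroot:
  "prod_decode n = (n - triangle (triroot n), triroot n - (n - triangle (triroot n)))"
proof -
  let ?r = "triroot n" and ?d = "n - triangle (triroot n)"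
  have "?d \<le> ?r" using triroot_bounds[of n] unfolding triangle_Suc by linarith
  moreover have "triangle ?r + ?d = n" using triroot_bounds[of n] by simp
  ultimately have "prod_encode (?d, ?r - ?d) = n"
    by (simp add: prod_encode_def)
  then show ?thesis by (metis prod_encode_inverse)
qed

definition triroot_rf :: rf where
  "triroot_rf = Prec Zero (Comp ifz_rf
     [Comp sub_rf [Comp Succ [Proj 1], Comp triangle_rf [Comp Succ [Proj 0]]],
      Comp Succ [Proj 0], Proj 0])"

lemma ev_triroot: "ev A triroot_rf [n] (triroot n)"
  unfolding triroot_rf_def
proof (induction n)
  case 0
  show ?case by (auto intro!: ev_Prec0 ev_Zero)
next
  case (Suc n)
  let ?r = "triroot n"
  have S: "ev A (Comp Succ [Proj 0]) [?r, n] (Suc ?r)"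
    "ev A (Comp Succ [Proj 1]) [?r, n] (Suc n)"
    by (auto intro!: ev_Comp1 ev_Proj_nth ev_Suc)
  have P: "ev A (Proj 0) [?r, n] ?r"
    by (auto intro!: ev_Proj_nth)
  show ?case
    unfolding triroot.simps
    by (rule ev_PrecS[OF Suc],
        rule ev_Comp3[OF ev_Comp2[OF S(2) ev_Comp1[OF S(1) ev_triangle] ev_sub] S(1) P ev_ifz])
qed

definition fst_rf :: rf where
  "fst_rf = Comp sub_rf [Comp triangle_rf [triroot_rf], Proj 0]"

definition snd_rf :: rf where
  "snd_rf = Comp sub_rf [fst_rf, triroot_rf]"

lemma ev_fst: "ev A fst_rf [n] (fst (prod_decode n))"
proof -
  have "ev A fst_rf [n] (n - triangle (triroot n))"
    unfolding fst_rf_def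
    by (rule ev_Comp2[OF ev_Comp1[OF ev_triroot ev_triangle] _ ev_sub]) (auto intro!: ev_Proj_nth)
  then show ?thesis by (simp add: prod_decode_triroot)
qed

lemma ev_snd: "ev A snd_rf [n] (snd (prod_decode n))"
proof -
  have "ev A snd_rf [n] (triroot n - fst (prod_decode n))"
    unfolding snd_rf_def
    by (rule ev_Comp2[OF ev_fst ev_triroot ev_sub])
  then show ?thesis by (simp add: prod_decode_triroot)
qed

section \<open>Encodable types and functions computable uniformly in the oracle\<close>

class enc =
  fixes enc :: "'a \<Rightarrow> nat"
  assumes enc_inj: "enc x = enc y \<Longrightarrow> x = y"

instantiation nat :: enc
begin
definition enc_nat :: "nat \<Rightarrow> nat" where "enc_nat n = n"
instance by standard (simp add: enc_nat_def)
end

instantiation bool :: enc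
begin
definition enc_bool :: "bool \<Rightarrow> nat" where "enc_bool b = (if b then 1 else 0)"
instance by standard (simp add: enc_bool_def split: if_splits)
end

instantiation prod :: (enc, enc) enc
begin
definition enc_prod :: "'a \<times> 'b \<Rightarrow> nat" where
  "enc_prod p = prod_encode (enc (fst p), enc (snd p))"
instance by standard (auto simp: enc_prod_def prod_eq_iff dest: enc_inj)
end

instantiation list :: (enc) enc
begin
definition enc_list :: "'a list \<Rightarrow> nat" where
  "enc_list xs = list_encode (map enc xs)"
instance
proof
  fix xs ys :: "'a list"
  assume "enc xs = enc ys"
  then have "map enc xs = map enc ys"
    by (simp add: enc_list_def inj_eq[OF inj_list_encode])
  then show "xs = ys" by (rule map_injective) (auto intro: injI enc_inj)
qed
end

lemma enc_eq_iff: "enc x = enc y \<longleftrightarrow> x = y"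
  by (auto dest: enc_inj)

lemma enc_Nil: "enc [] = 0"
  by (simp add: enc_list_def)

lemma enc_Cons: "enc (x # xs) = Suc (prod_encode (enc x, enc xs))"
  by (simp add: enc_list_def)

text \<open>One program has to give the right value under all oracles. It can thus be composed with
  programs that query \<open>Orc\<close>, and it witnesses computability relative to any
  set.\<close>

definition cmp :: "('a::enc \<Rightarrow> 'b::enc) \<Rightarrow> bool" where
  "cmp f \<longleftrightarrow> (\<exists>p. \<forall>A x. ev A p [enc x] (enc (f x)))"

lemma cmpI: "(\<And>A x. ev A p [enc x] (enc (f x))) \<Longrightarrow> cmp f"
  by (auto simp: cmp_def)

lemma cmpE:
  assumes "cmp f"
  obtains p where "\<And>A x. ev A p [enc x] (enc (f x))"
  using assms by (auto simp: cmp_def)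

named_theorems cmp_intros

lemma cmp_id [cmp_intros]: "cmp (\<lambda>x. x)"
  by (rule cmpI[where p = "Proj 0"]) (auto intro: ev_Proj_nth)

lemma cmp_const [cmp_intros]: "cmp (\<lambda>x. c)"
  by (rule cmpI[OF ev_const])

lemma cmp_comp:
  assumes "cmp f" "cmp g"
  shows "cmp (\<lambda>x. f (g x))"
proof -
  obtain p q where "\<And>A x. ev A p [enc x] (enc (f x))" "\<And>A x. ev A q [enc x] (enc (g x))"
    using assms by (metis cmpE)
  then show ?thesis
    by (intro cmpI[where p = "Comp p [q]"]) (blast intro: ev_Comp1)
qed

lemma cmp_prim1:
  assumes "cmp f" "\<And>A x. ev A r [enc (f x)] (enc (h x))"
  shows "cmp h"
  using assms by (metis cmpE cmpI ev_Comp1)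

lemma cmp_prim2:
  assumes "cmp f" "cmp g" "\<And>A x. ev A r [enc (f x), enc (g x)] (enc (h x))"
  shows "cmp h"
proof -
  obtain p q where "\<And>A x. ev A p [enc x] (enc (f x))" "\<And>A x. ev A q [enc x] (enc (g x))"
    using assms by (metis cmpE)
  then show ?thesis using assms(3)
    by (intro cmpI[where p = "Comp r [p, q]"]) (blast intro: ev_Comp2)
qed

lemma cmp_prim3:
  assumes "cmp f" "cmp g" "cmp k"
    "\<And>A x. ev A r [enc (f x), enc (g x), enc (k x)] (enc (h x))"
  shows "cmp h"
proof -
  obtain p q q' where "\<And>A x. ev A p [enc x] (enc (f x))" "\<And>A x. ev A q [enc x] (enc (g x))"
    "\<And>A x. ev A q' [enc x] (enc (k x))"
    using assms by (metis cmpE)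
  then show ?thesis using assms(4)
    by (intro cmpI[where p = "Comp r [p, q, q']"]) (blast intro: ev_Comp3)
qed

lemma cmp_Suc [cmp_intros]: "cmp f \<Longrightarrow> cmp (\<lambda>x. Suc (f x))"
  by (rule cmp_prim1[where r = Succ]) (auto simp: enc_nat_def intro: ev_Suc)

lemma cmp_add [cmp_intros]: "cmp f \<Longrightarrow> cmp g \<Longrightarrow> cmp (\<lambda>x. f x + g x :: nat)"
  by (rule cmp_prim2[where r = add_rf and f = f and g = g]) (auto simp: enc_nat_def intro: ev_add)

lemma cmp_diff [cmp_intros]: "cmp f \<Longrightarrow> cmp g \<Longrightarrow> cmp (\<lambda>x. f x - g x :: nat)"
  by (rule cmp_prim2[where r = sub_rf and f = g and g = f]) (auto simp: enc_nat_def intro: ev_sub)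

lemma cmp_Pair [cmp_intros]: "cmp f \<Longrightarrow> cmp g \<Longrightarrow> cmp (\<lambda>x. (f x, g x))"
  by (rule cmp_prim2[where r = pair_rf and f = f and g = g]) (auto simp: enc_prod_def intro: ev_pair)

lemma cmp_fst [cmp_intros]: "cmp f \<Longrightarrow> cmp (\<lambda>x. fst (f x))"
proof (erule cmp_prim1[where r = fst_rf])
  show "ev A fst_rf [enc (f x)] (enc (fst (f x)))" for A x
    using ev_fst[of A "enc (f x)"] by (simp add: enc_prod_def)
qed

lemma cmp_snd [cmp_intros]: "cmp f \<Longrightarrow> cmp (\<lambda>x. snd (f x))"
proof (erule cmp_prim1[where r = snd_rf])
  show "ev A snd_rf [enc (f x)] (enc (snd (f x)))" for A x
    using ev_snd[of A "enc (f x)"] by (simp add: enc_prod_def)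
qed

text \<open>The body must be computable jointly in the context \<open>x\<close> and the bound
  variables, packed into one nested pair. The rules for all binding operators below have this form,
  so that they chain under \<open>intro\<close>.\<close>

lemma cmp_case_prod [cmp_intros]:
  assumes "cmp f" "cmp (\<lambda>p. h (fst p) (fst (snd p)) (snd (snd p)))"
  shows "cmp (\<lambda>x. case f x of (a, b) \<Rightarrow> h x a b)"
proof -
  have "cmp (\<lambda>x. (x, f x))" using assms(1) by (intro cmp_intros)
  from cmp_comp[OF assms(2) this] show ?thesis by (simp add: case_prod_beta)
qed

lemma cmp_If [cmp_intros]:
  assumes "cmp c" "cmp f" "cmp g"
  shows "cmp (\<lambda>x. if c x then f x else g x)"
proof (rule cmp_prim3[OF assms(1) assms(3) assms(2)])
  show "ev A ifz_rf [enc (c x), enc (g x), enc (f x)] (enc (if c x then f x else g x))" for A x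
    using ev_ifz[of A "enc (c x)" "enc (g x)" "enc (f x)"] by (auto simp: enc_bool_def)
qed

lemma cmp_eq_0: "cmp f \<Longrightarrow> cmp (\<lambda>x. f x = (0::nat))"
proof (rule cmp_prim3[where f = f and g = "\<lambda>_. 1::nat" and k = "\<lambda>_. 0::nat"])
  show "ev A ifz_rf [enc (f x), enc (1::nat), enc (0::nat)] (enc (f x = 0))" for A x
    using ev_ifz[of A "f x" 1 0] by (auto simp: enc_bool_def enc_nat_def)
qed (auto intro: cmp_const)

lemma cmp_le [cmp_intros]: "cmp f \<Longrightarrow> cmp g \<Longrightarrow> cmp (\<lambda>x. f x \<le> (g x :: nat))"
  using cmp_eq_0[OF cmp_diff, of f g] by (simp add: cmp_def)

lemma cmp_less [cmp_intros]: "cmp f \<Longrightarrow> cmp g \<Longrightarrow> cmp (\<lambda>x. f x < (g x :: nat))"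
  using cmp_le[OF cmp_Suc, of f g] by (simp add: Suc_le_eq)

lemma cmp_not [cmp_intros]: "cmp P \<Longrightarrow> cmp (\<lambda>x. \<not> P x)"
  using cmp_If[of P "\<lambda>_. False" "\<lambda>_. True"] by (simp add: cmp_const if_bool_eq_conj)

lemma cmp_conj [cmp_intros]: "cmp P \<Longrightarrow> cmp Q \<Longrightarrow> cmp (\<lambda>x. P x \<and> Q x)"
  using cmp_If[of P Q "\<lambda>_. False"] by (simp add: cmp_const if_bool_eq_conj conj_commute cong: conj_cong)

lemma cmp_disj [cmp_intros]: "cmp P \<Longrightarrow> cmp Q \<Longrightarrow> cmp (\<lambda>x. P x \<or> Q x)"
  using cmp_not[OF cmp_conj[OF cmp_not cmp_not], of P Q] by simp

lemma cmp_enc: "cmp f \<Longrightarrow> cmp (\<lambda>x. enc (f x))"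
  by (simp add: cmp_def enc_nat_def)

lemma cmp_eq [cmp_intros]: "cmp f \<Longrightarrow> cmp g \<Longrightarrow> cmp (\<lambda>x. f x = g x)"
  using cmp_conj[OF cmp_le[OF cmp_enc cmp_enc] cmp_le[OF cmp_enc cmp_enc], of f g g f]
  by (simp add: order_eq_iff[symmetric] enc_eq_iff)

lemma cmp_rec_nat [cmp_intros]:
  assumes "cmp n" "cmp a" "cmp (\<lambda>p. f (fst p) (fst (snd p)) (snd (snd p)))"
  shows "cmp (\<lambda>x. rec_nat (a x) (f x) (n x))"
proof -
  obtain p where p: "\<And>A x. ev A p [enc x] (enc (a x))"
    using assms(2) by (metis cmpE)
  obtain q where q: "\<And>A x. ev A q [enc x] (enc (f (fst x) (fst (snd x)) (snd (snd x))))"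
    using assms(3) unfolding cmp_def by blast
  \<comment> \<open>\<open>Prec\<close> delivers recursive value, counter and parameter in this
    order; the pairing rearranges them to \<open>(x, m, r)\<close>.\<close>
  let ?q = "Comp q [Comp pair_rf [Proj 2, Comp pair_rf [Proj 1, Proj 0]]]"
  have q': "ev A ?q [enc r, m, enc x] (enc (f x m r))" for A x m r
  proof -
    have *: "ev A (Proj 0) [enc r, m, enc x] (enc r)" "ev A (Proj 1) [enc r, m, enc x] m"
      "ev A (Proj 2) [enc r, m, enc x] (enc x)"
      by (auto intro: ev_Proj_nth)
    show ?thesis
      using ev_Comp1[OF ev_Comp2[OF *(3) ev_Comp2[OF *(2) *(1) ev_pair] ev_pair], of q]
        q[of A "(x, m, r)"]
      by (simp add: enc_prod_def enc_nat_def)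
  qed
  have "ev A (Prec p ?q) [m, enc x] (enc (rec_nat (a x) (f x) m))" for A x m
  proof (induction m)
    case 0
    show ?case using ev_Prec0[OF p] by simp
  next
    case (Suc m)
    show ?case using ev_PrecS[OF Suc q'] by simp
  qed
  then have "ev A (Prec p ?q) [enc (n x), enc x] (enc (rec_nat (a x) (f x) (n x)))" for A x
    unfolding enc_nat_def .
  then show ?thesis
    by (rule cmp_prim2[OF assms(1) cmp_id])
qed

lemma cmp_prod_decode [cmp_intros]: "cmp f \<Longrightarrow> cmp (\<lambda>x. prod_decode (f x))"
  by (simp add: cmp_def enc_prod_def enc_nat_def)

lemma cmp_prod_encode [cmp_intros]: "cmp f \<Longrightarrow> cmp (\<lambda>x. prod_encode (f x))"
  by (simp add: cmp_def enc_prod_def enc_nat_def)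

lemma map_enc_nat [simp]: "map enc (xs :: nat list) = xs"
  by (induction xs) (auto simp: enc_nat_def)

lemma cmp_list_decode [cmp_intros]: "cmp f \<Longrightarrow> cmp (\<lambda>x. list_decode (f x))"
  by (simp add: cmp_def enc_list_def enc_nat_def)

lemma cmp_list_encode [cmp_intros]: "cmp f \<Longrightarrow> cmp (\<lambda>x. list_encode (f x))"
  by (simp add: cmp_def enc_list_def enc_nat_def)

lemma cmp_Cons [cmp_intros]: "cmp f \<Longrightarrow> cmp g \<Longrightarrow> cmp (\<lambda>x. f x # g x)"
  using cmp_Suc[OF cmp_enc[OF cmp_Pair[of f g]]]
  by (simp add: cmp_def enc_Cons enc_prod_def enc_nat_def)

lemma cmp_mult [cmp_intros]:
  assumes "cmp f" "cmp g" shows "cmp (\<lambda>x. f x * g x :: nat)"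
proof -
  have "rec_nat 0 (\<lambda>_ r. r + b) a = a * b" for a b :: nat
    by (induction a) auto
  moreover have "cmp (\<lambda>x. rec_nat 0 (\<lambda>_ r. r + g x) (f x))"
    by (intro cmp_intros assms cmp_comp[OF assms(2)])
  ultimately show ?thesis by simp
qed

lemma cmp_power [cmp_intros]:
  assumes "cmp f" "cmp g" shows "cmp (\<lambda>x. f x ^ g x :: nat)"
proof -
  have "rec_nat 1 (\<lambda>_ r. r * b) a = b ^ a" for a b :: nat
    by (induction a) auto
  moreover have "cmp (\<lambda>x. rec_nat 1 (\<lambda>_ r. r * f x) (g x))"
    by (intro cmp_intros assms cmp_comp[OF assms(1)])
  ultimately show ?thesis by simp
qed

lemma cmp_tl [cmp_intros]:
  assumes "cmp f" shows "cmp (\<lambda>x. tl (f x))"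
proof -
  have "cmp (\<lambda>x. if enc (f x) = 0 then 0 else snd (prod_decode (enc (f x) - 1)))"
    by (intro cmp_intros cmp_enc assms)
  moreover have "(if enc xs = 0 then 0 else snd (prod_decode (enc xs - 1))) = enc (tl xs)"
    for xs :: "'b list"
    by (cases xs) (auto simp: enc_Nil enc_Cons)
  ultimately show ?thesis by (simp add: cmp_def enc_nat_def)
qed

lemma cmp_case_list [cmp_intros]:
  fixes f :: "'a::enc \<Rightarrow> 'e::enc list" and h :: "'a \<Rightarrow> 'e \<Rightarrow> 'e list \<Rightarrow> 'r::enc"
  assumes "cmp f" "cmp a" "cmp (\<lambda>p. h (fst p) (fst (snd p)) (snd (snd p)))"
  shows "cmp (\<lambda>x. case f x of [] \<Rightarrow> a x | y # ys \<Rightarrow> h x y ys)"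
proof -
  \<comment> \<open>The head of the empty list is an arbitrary constant; the test for emptiness
    below discards it.\<close>
  let ?hd = "\<lambda>xs. case xs of [] \<Rightarrow> undefined | y # ys \<Rightarrow> y"
  have "cmp (\<lambda>x. if enc (f x) = 0 then enc (undefined :: 'e) else fst (prod_decode (enc (f x) - 1)))"
    by (intro cmp_intros cmp_enc assms)
  moreover have "(if enc xs = 0 then enc (undefined :: 'e) else fst (prod_decode (enc xs - 1)))
    = enc (?hd xs)" for xs :: "'e list"
    by (cases xs) (auto simp: enc_Nil enc_Cons)
  ultimately have "cmp (\<lambda>x. enc (?hd (f x)))" by simp
  then have hd: "cmp (\<lambda>x. ?hd (f x))" by (simp add: cmp_def enc_nat_def)
  have "cmp (\<lambda>x. (x, ?hd (f x), tl (f x)))"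
    by (intro cmp_intros hd assms)
  from cmp_comp[OF assms(3) this]
  have "cmp (\<lambda>x. if f x = [] then a x else h x (?hd (f x)) (tl (f x)))"
    by (intro cmp_intros assms) simp
  moreover have "(if xs = [] then a x else h x (?hd xs) (tl xs)) =
    (case xs of [] \<Rightarrow> a x | y # ys \<Rightarrow> h x y ys)" for x xs
    by (cases xs) auto
  ultimately show ?thesis by simp
qed

lemma cmp_case_nat [cmp_intros]:
  assumes "cmp f" "cmp a" "cmp (\<lambda>p. h (fst p) (snd p))"
  shows "cmp (\<lambda>x. case f x of 0 \<Rightarrow> a x | Suc y \<Rightarrow> h x y)"
proof -
  have "cmp (\<lambda>x. (x, f x - 1))"
    by (intro cmp_intros assms)
  from cmp_comp[OF assms(3) this]
  have "cmp (\<lambda>x. if f x = 0 then a x else h x (f x - 1))"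
    by (intro cmp_intros assms) simp
  moreover have "(if n = 0 then a x else h x (n - 1)) =
    (case n of 0 \<Rightarrow> a x | Suc y \<Rightarrow> h x y)" for x n
    by (cases n) auto
  ultimately show ?thesis by simp
qed

lemma length_le_enc: "length xs \<le> enc xs"
proof (induction xs)
  case (Cons x xs)
  then show ?case
    using le_prod_encode_2[of "enc xs" "enc x"] by (simp add: enc_Cons)
qed simp

text \<open>The recursion works on the pair of remaining list and accumulator. Its number of rounds
  is the code of the list, which is at least the length; once the list is used up the pair no longer
  changes, so surplus rounds do no harm. Computability of \<open>length\<close> is itself derived
  from folding.\<close>

lemma cmp_fold [cmp_intros]:
  assumes "cmp l" "cmp a" "cmp (\<lambda>p. f (fst p) (fst (snd p)) (snd (snd p)))"
  shows "cmp (\<lambda>x. fold (f x) (l x) (a x))"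
proof -
  let ?step = "\<lambda>x r. case fst r of [] \<Rightarrow> r | y # ys \<Rightarrow> (ys, f x y (snd r))"
  have *: "snd (rec_nat (xs, b) (\<lambda>_. ?step x) k) = fold (f x) xs b"
    if "length xs \<le> k" for xs b x k
  proof -
    have "rec_nat (xs, b) (\<lambda>_. ?step x) k = (drop k xs, fold (f x) (take k xs) b)"
    proof (induction k)
      case (Suc k)
      show ?case
      proof (cases "k < length xs")
        case True
        then have "drop k xs = xs ! k # drop (Suc k) xs" "take (Suc k) xs = take k xs @ [xs ! k]"
          by (auto simp: Cons_nth_drop_Suc take_Suc_conv_app_nth)
        then show ?thesis using Suc by simp
      qed (use Suc in auto)
    qed simp
    then show ?thesis using that by simp
  qed
  have f': "cmp (\<lambda>q. f (fst (fst q)) (fst (snd q)) (snd (snd (snd (fst q)))))"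
    by (rule cmp_comp[OF assms(3),
          of "\<lambda>q. (fst (fst q), fst (snd q), snd (snd (snd (fst q))))", simplified])
      (intro cmp_intros)
  have "cmp (\<lambda>x. snd (rec_nat (l x, a x) (\<lambda>_. ?step x) (enc (l x))))"
    by (intro cmp_intros cmp_enc assms f')
  moreover have "snd (rec_nat (l x, a x) (\<lambda>_. ?step x) (enc (l x))) = fold (f x) (l x) (a x)" for x
    using *[OF length_le_enc] .
  ultimately show ?thesis by simp
qed

lemma cmp_rev [cmp_intros]: "cmp f \<Longrightarrow> cmp (\<lambda>x. rev (f x))"
proof -
  assume "cmp f"
  then have "cmp (\<lambda>x. fold (\<lambda>e acc. e # acc) (f x) [])" by (intro cmp_intros)
  then show ?thesis by (simp add: fold_Cons_rev)
qed

lemma cmp_foldr [cmp_intros]: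
  assumes "cmp l" "cmp a" "cmp (\<lambda>p. f (fst p) (fst (snd p)) (snd (snd p)))"
  shows "cmp (\<lambda>x. foldr (f x) (l x) (a x))"
  using cmp_fold[OF cmp_rev[OF assms(1)] assms(2,3)] by (simp add: foldr_conv_fold)

lemma cmp_append [cmp_intros]:
  assumes "cmp f" "cmp g" shows "cmp (\<lambda>x. f x @ g x)"
proof -
  have "foldr (\<lambda>e acc. e # acc) xs ys = xs @ ys" for xs ys :: "'b list"
    by (induction xs) auto
  moreover have "cmp (\<lambda>x. foldr (\<lambda>e acc. e # acc) (f x) (g x))"
    by (intro cmp_intros assms)
  ultimately show ?thesis by simp
qed

lemma cmp_map [cmp_intros]:
  assumes "cmp l" "cmp (\<lambda>p. f (fst p) (snd p))"
  shows "cmp (\<lambda>x. map (f x) (l x))"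
proof -
  have f: "cmp (\<lambda>p. f (fst p) (fst (snd p)))"
    by (rule cmp_comp[OF assms(2), of "\<lambda>p. (fst p, fst (snd p))", simplified]) (intro cmp_intros)
  have "foldr (\<lambda>e acc. f x e # acc) xs [] = map (f x) xs" for x xs
    by (induction xs) auto
  moreover have "cmp (\<lambda>x. foldr (\<lambda>e acc. f x e # acc) (l x) [])"
    by (intro cmp_intros assms f)
  ultimately show ?thesis by simp
qed

lemma cmp_takeWhile [cmp_intros]:
  assumes "cmp l" "cmp (\<lambda>p. P (fst p) (snd p))"
  shows "cmp (\<lambda>x. takeWhile (P x) (l x))"
proof -
  have P: "cmp (\<lambda>p. P (fst p) (fst (snd p)))"
    by (rule cmp_comp[OF assms(2), of "\<lambda>p. (fst p, fst (snd p))", simplified]) (intro cmp_intros)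
  have "foldr (\<lambda>e acc. if P x e then e # acc else []) xs [] = takeWhile (P x) xs" for x xs
    by (induction xs) auto
  moreover have "cmp (\<lambda>x. foldr (\<lambda>e acc. if P x e then e # acc else []) (l x) [])"
    by (intro cmp_intros assms P)
  ultimately show ?thesis by simp
qed

lemma cmp_concat [cmp_intros]:
  assumes "cmp f" shows "cmp (\<lambda>x. concat (f x))"
proof -
  have "foldr (\<lambda>e acc. e @ acc) xs [] = concat xs" for xs :: "'b list list"
    by (induction xs) auto
  moreover have "cmp (\<lambda>x. foldr (\<lambda>e acc. e @ acc) (f x) [])"
    by (intro cmp_intros assms)
  ultimately show ?thesis by simp
qed

lemma cmp_length [cmp_intros]:
  assumes "cmp f" shows "cmp (\<lambda>x. length (f x))"
proof -
  have "foldr (\<lambda>e n. Suc n) xs 0 = length xs" for xs :: "'b list"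
    by (induction xs) auto
  moreover have "cmp (\<lambda>x. foldr (\<lambda>e n. Suc n) (f x) 0)"
    by (intro cmp_intros assms)
  ultimately show ?thesis by simp
qed

lemma cmp_upt [cmp_intros]:
  assumes "cmp f" shows "cmp (\<lambda>x. [0..<f x])"
proof -
  have "rec_nat [] (\<lambda>m r. r @ [m]) n = [0..<n]" for n :: nat
    by (induction n) auto
  moreover have "cmp (\<lambda>x. rec_nat [] (\<lambda>m r. r @ [m]) (f x))"
    by (intro cmp_intros assms)
  ultimately show ?thesis by simp
qed

lemma cmp_drop [cmp_intros]:
  assumes "cmp n" "cmp f" shows "cmp (\<lambda>x. drop (n x) (f x))"
proof -
  have "rec_nat xs (\<lambda>_ r. tl r) n = drop n xs" for n and xs :: "'b list"
    by (induction n) (auto simp: drop_Suc tl_drop)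
  moreover have "cmp (\<lambda>x. rec_nat (f x) (\<lambda>_ r. tl r) (n x))"
    by (intro cmp_intros assms)
  ultimately show ?thesis by simp
qed

lemma cmp_take [cmp_intros]:
  assumes "cmp n" "cmp f" shows "cmp (\<lambda>x. take (n x) (f x))"
proof -
  have "rev (drop (length xs - n) (rev xs)) = take n xs" for n and xs :: "'b list"
    by (metis rev_rev_ident rev_take)
  moreover have "cmp (\<lambda>x. rev (drop (length (f x) - n x) (rev (f x))))"
    by (intro cmp_intros assms)
  ultimately show ?thesis by simp
qed

lemma cmp_replicate [cmp_intros]:
  assumes "cmp n" "cmp f" shows "cmp (\<lambda>x. replicate (n x) (f x))"
proof -
  have f: "cmp (\<lambda>p. f (fst p))" by (rule cmp_comp[OF assms(2)]) (intro cmp_intros)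
  have "rec_nat [] (\<lambda>_ r. c # r) n = replicate n c" for n and c :: 'b
    by (induction n) auto
  moreover have "cmp (\<lambda>x. rec_nat [] (\<lambda>_ r. f x # r) (n x))"
    by (intro cmp_intros assms f)
  ultimately show ?thesis by simp
qed

lemma cmp_prefix [cmp_intros]: "cmp f \<Longrightarrow> cmp g \<Longrightarrow> cmp (\<lambda>x. prefix (f x) (g x))"
proof -
  assume f: "cmp f" and g: "cmp g"
  have "take (length xs) ys = xs \<longleftrightarrow> prefix xs ys" for xs ys :: "'b list"
    by (auto simp: prefix_def) (metis append_take_drop_id)
  moreover have "cmp (\<lambda>x. take (length (f x)) (g x) = f x)"
    by (intro cmp_intros f g)
  ultimately show ?thesis by simp
qed

lemma cmp_Bex_set [cmp_intros]:
  assumes "cmp l" "cmp (\<lambda>p. P (fst p) (snd p))"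
  shows "cmp (\<lambda>x. \<exists>y\<in>set (l x). P x y)"
proof -
  have P: "cmp (\<lambda>p. P (fst p) (fst (snd p)))"
    by (rule cmp_comp[OF assms(2), of "\<lambda>p. (fst p, fst (snd p))", simplified]) (intro cmp_intros)
  have "foldr (\<lambda>e b. P x e \<or> b) xs False = (\<exists>y\<in>set xs. P x y)" for x xs
    by (induction xs) auto
  moreover have "cmp (\<lambda>x. foldr (\<lambda>e b. P x e \<or> b) (l x) False)"
    by (intro cmp_intros assms P)
  ultimately show ?thesis by simp
qed

lemma cmp_Ex_less [cmp_intros]:
  assumes "cmp n" "cmp (\<lambda>p. P (fst p) (snd p))"
  shows "cmp (\<lambda>x. \<exists>i::nat. i < n x \<and> P x i)"
proof -
  have "cmp (\<lambda>x. \<exists>i\<in>set [0..<n x]. P x i)" by (intro cmp_intros assms)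
  then show ?thesis by (simp add: Bex_def)
qed

lemma cmp_sum [cmp_intros]:
  assumes "cmp n" "cmp (\<lambda>p. f (fst p) (snd p))"
  shows "cmp (\<lambda>x. \<Sum>i<n x. (f x (i::nat) :: nat))"
proof -
  have f: "cmp (\<lambda>p. f (fst p) (fst (snd p)))"
    by (rule cmp_comp[OF assms(2), of "\<lambda>p. (fst p, fst (snd p))", simplified]) (intro cmp_intros)
  have "rec_nat 0 (\<lambda>i r. r + f x i) m = (\<Sum>i<m. f x i)" for x m
    by (induction m) auto
  moreover have "cmp (\<lambda>x. rec_nat 0 (\<lambda>i r. r + f x i) (n x))"
    by (intro cmp_intros assms f)
  ultimately show ?thesis by simp
qed

lemma cmp_remdups_adj [cmp_intros]:
  assumes "cmp f" shows "cmp (\<lambda>x. remdups_adj (f x))"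
proof -
  let ?g = "\<lambda>x acc. case acc of [] \<Rightarrow> [x] | y # ys \<Rightarrow> if x = y then y # ys else x # y # ys"
  have "foldr ?g xs [] = remdups_adj xs" for xs :: "'b list"
    by (induction xs) (auto simp: remdups_adj_Cons)
  moreover have "cmp (\<lambda>x. foldr ?g (f x) [])"
    by (intro cmp_intros assms)
  ultimately show ?thesis by simp
qed

lemma cmp_Least [cmp_intros]:
  assumes "cmp (\<lambda>p. P (fst p) (snd p))" "\<And>x. \<exists>n. P x n"
  shows "cmp (\<lambda>x. LEAST n::nat. P x n)"
proof -
  have nP: "cmp (\<lambda>p. \<not> P (fst p) (snd p))" by (intro cmp_intros assms)
  \<comment> \<open>Truth is coded by 0, since \<open>Mu\<close> stops at the first 0.\<close>
  obtain p where p: "\<And>A x n. ev A p [prod_encode (enc x, n)] (if P x n then 0 else 1)"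
  proof -
    from nP obtain p where p: "\<And>A y. ev A p [enc y] (enc (\<not> P (fst y) (snd y)))"
      unfolding cmp_def by blast
    have "ev A p [prod_encode (enc x, n)] (if P x n then 0 else 1)" for A x n
      using p[of A "(x, n)"] by (auto simp: enc_prod_def enc_nat_def enc_bool_def)
    then show ?thesis by (rule that)
  qed
  let ?p = "Comp p [Comp pair_rf [Proj 1, Proj 0]]"
  have p': "ev A ?p [n, enc x] (if P x n then 0 else 1)" for A x n
    by (rule ev_Comp1[OF ev_Comp2[OF _ _ ev_pair] p]) (auto intro: ev_Proj_nth)
  have "ev A (Mu ?p) [enc x] (LEAST n. P x n)" for A x
  proof (rule ev_Mu)
    show "ev A ?p [LEAST n. P x n, enc x] 0"
      using p'[of A "LEAST n. P x n" x] unfolding if_P[OF LeastI_ex[OF assms(2)[of x]]] .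
    show "\<forall>m<LEAST n. P x n. \<exists>y. ev A ?p [m, enc x] (Suc y)"
    proof (intro allI impI)
      fix m assume "m < (LEAST n. P x n)"
      then have "\<not> P x m" by (rule not_less_Least)
      then show "\<exists>y. ev A ?p [m, enc x] (Suc y)"
        using p'[of A m x] by auto
    qed
  qed
  then show ?thesis by (intro cmpI[where p = "Mu ?p"]) (simp add: enc_nat_def)
qed

lemma comp1_relI: "cmp (f :: nat \<Rightarrow> nat) \<Longrightarrow> comp1_rel A f"
  by (auto simp: cmp_def comp1_rel_def enc_nat_def)

lemma comp2_relI:
  assumes "cmp (\<lambda>p. f (fst p) (snd p) :: nat)"
  shows "comp2_rel A f"
proof -
  obtain p where "\<And>A x. ev A p [enc x] (enc (f (fst x) (snd x)))"
    using assms unfolding cmp_def by blast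
  from this[of _ "(_, _)"] have "ev A p [prod_encode (x, t)] (f x t)" for x t
    by (simp add: enc_prod_def enc_nat_def)
  then show ?thesis
    unfolding comp2_rel_def using ev_Comp1[OF ev_pair] by blast
qed

section \<open>Codes of programs, determinism, and indices of finite sets\<close>

lemma code_inj: "code p = code q \<Longrightarrow> p = q"
proof (induction p arbitrary: q)
  case (Comp f gs)
  then obtain f' gs' where q: "q = Comp f' gs'"
    by (cases q) (auto simp: prod_encode_eq)
  with Comp.prems have "code f = code f'" "map code gs = map code gs'"
    by (auto simp: prod_encode_eq inj_eq[OF inj_list_encode])
  then have "f = f'" using Comp.IH(1) by blast
  moreover have "gs = gs'"
    using \<open>map code gs = map code gs'\<close> Comp.IH(2)
    by (metis list.inj_map_strong)
  ultimately show ?case using q by simp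
next
  case (Prec f g)
  then show ?case by (cases q) (auto simp: prod_encode_eq)
next
  case (Mu f)
  then show ?case by (cases q) (auto simp: prod_encode_eq)
next
  case Zero
  then show ?case by (cases q) (auto simp: prod_encode_eq)
next
  case Succ
  then show ?case by (cases q) (auto simp: prod_encode_eq)
next
  case (Proj i)
  then show ?case by (cases q) (auto simp: prod_encode_eq)
next
  case Orc
  then show ?case by (cases q) (auto simp: prod_encode_eq)
qed

inductive_cases ev_ZeroE: "ev A Zero xs y"
inductive_cases ev_SuccE: "ev A Succ xs y"
inductive_cases ev_ProjE: "ev A (Proj i) xs y"
inductive_cases ev_CompE: "ev A (Comp f gs) xs y"
inductive_cases ev_PrecE: "ev A (Prec f g) xs y"
inductive_cases ev_MuE: "ev A (Mu f) xs y"
inductive_cases ev_OrcE: "ev A Orc xs y"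

lemma ev_det: "ev A p xs y \<Longrightarrow> ev A p xs z \<Longrightarrow> y = z"
proof (induction arbitrary: z rule: ev.induct)
  case (ev_Comp xs gs ys f y)
  from ev_Comp.prems obtain ys' where
    ys': "list_all2 (\<lambda>g y. ev A g xs y) gs ys'" "ev A f ys' z" by (rule ev_CompE)
  have "ys = ys'"
    using ev_Comp.IH(1) ys'(1)
  proof (induction arbitrary: ys' rule: list_all2_induct)
    case (Cons g gs y ys)
    then show ?case by (cases ys') auto
  qed auto
  then show ?case using ev_Comp.IH(2) ys'(2) by blast
next
  case (ev_Prec0 f xs y g)
  from ev_Prec0.prems show ?case
    by (rule ev_PrecE) (auto dest: ev_Prec0.IH)
next
  case (ev_PrecS f g n xs y z')
  from ev_PrecS.prems obtain y' where y': "ev A (Prec f g) (n # xs) y'" "ev A g (y' # n # xs) z"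
    by (rule ev_PrecE) auto
  from ev_PrecS.IH(1)[OF y'(1)] y'(2) show ?case by (simp add: ev_PrecS.IH(2))
next
  case (ev_Mu f n xs)
  from ev_Mu.prems have z: "ev A f (z # xs) 0" "\<forall>m<z. \<exists>y. ev A f (m # xs) (Suc y)"
    by (rule ev_MuE, blast)+
  show ?case
  proof (cases n z rule: linorder_cases)
    case less
    then obtain y where "ev A f (n # xs) (Suc y)" using z(2) by blast
    from ev_Mu.IH(1)[OF this] show ?thesis by simp
  next
    case greater
    then obtain y where "\<And>w. ev A f (z # xs) w \<Longrightarrow> Suc y = w" using ev_Mu.IH(2) by blast
    from this[OF z(1)] show ?thesis by simp
  qed
next
  case ev_Zero
  then show ?case by (rule ev_ZeroE) simp
next
  case ev_Succ
  then show ?case by (rule ev_SuccE) simp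
next
  case ev_Proj
  from ev_Proj.prems show ?case by (rule ev_ProjE) simp
next
  case ev_Orc
  then show ?case by (rule ev_OrcE) simp
qed

lemma W_code: "W (code p) = {x. \<exists>y. ev {} p [x] y}"
  unfolding W_def by (metis code_inj)

text \<open>The program for \<open>v\<close> searches with a test that ignores the search variable:
  it halts at 0 if \<open>x\<close> lies in \<open>v\<close>, and never otherwise. The list enters
  as the constant \<open>const_rf (enc v)\<close>, whose code is obtained from \<open>v\<close> by
  recursion, an instance of the s-m-n theorem done by hand.\<close>

lemma ex_W_index: "\<exists>idx :: nat list \<Rightarrow> nat. cmp idx \<and> (\<forall>v. W (idx v) = set v)"
proof -
  have "cmp (\<lambda>p :: nat list \<times> nat. \<not> (\<exists>y\<in>set (fst p). y = snd p))" by (intro cmp_intros)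
  then have "cmp (\<lambda>p :: nat list \<times> nat. snd p \<notin> set (fst p))" by simp
  then obtain d where d: "\<And>A p. ev A d [enc (p :: nat list \<times> nat)] (enc (snd p \<notin> set (fst p)))"
    unfolding cmp_def by blast
  let ?D = "Comp d [Comp pair_rf [Proj 1, Proj 2]]"
  have D: "ev A ?D [n, enc v, x] (enc (x \<notin> set v))" for A n x and v :: "nat list"
  proof (rule ev_Comp1[OF ev_Comp2[OF _ _ ev_pair]])
    show "ev A d [prod_encode (enc v, x)] (enc (x \<notin> set v))"
      using d[of A "(v, x)"] by (simp add: enc_prod_def enc_nat_def)
  qed (auto intro: ev_Proj_nth)
  let ?P = "\<lambda>v :: nat list. Comp (Mu ?D) [const_rf (enc v), Proj 0]"
  have W: "W (code (?P v)) = set v" for v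
  proof -
    have "(\<exists>y. ev {} (?P v) [x] y) \<longleftrightarrow> x \<in> set v" for x
    proof
      assume "\<exists>y. ev {} (?P v) [x] y"
      then obtain y ys where ys: "list_all2 (\<lambda>g y. ev {} g [x] y) [const_rf (enc v), Proj 0] ys"
        and y: "ev {} (Mu ?D) ys y"
        by (auto elim: ev_CompE)
      from ys obtain a b where "ys = [a, b]" "ev {} (const_rf (enc v)) [x] a" "ev {} (Proj 0) [x] b"
        by (auto simp: list_all2_Cons1)
      then have "ys = [enc v, x]"
        using ev_det[OF ev_const] by (auto elim: ev_ProjE)
      with y have "ev {} ?D [y, enc v, x] 0" by (auto elim: ev_MuE)
      from ev_det[OF this D] show "x \<in> set v" by (auto simp: enc_bool_def split: if_splits)
    next
      assume x: "x \<in> set v"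
      have "ev {} (Mu ?D) [enc v, x] 0"
        using D[of "{}" 0 v x] x by (intro ev_Mu) (auto simp: enc_bool_def)
      have "ev {} (?P v) [x] 0"
        by (rule ev_Comp2[OF ev_const ev_Proj_nth \<open>ev {} (Mu ?D) _ _\<close>]) auto
      then show "\<exists>y. ev {} (?P v) [x] y" ..
    qed
    then show ?thesis by (simp only: W_code Collect_mem_eq)
  qed
  have rec: "rec_nat (code Zero) (\<lambda>_ r. prod_encode (3, prod_encode (code Succ, list_encode [r])))
      = (\<lambda>n. code (const_rf n))"
  proof
    show "rec_nat (code Zero) (\<lambda>_ r. prod_encode (3, prod_encode (code Succ, list_encode [r]))) n
      = code (const_rf n)" for n
      by (induction n) auto
  qed
  have "cmp (rec_nat (code Zero)
      (\<lambda>_ r. prod_encode (3, prod_encode (code Succ, list_encode [r]))))"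
    using cmp_rec_nat[OF cmp_id cmp_const, of "\<lambda>_ _ r. prod_encode (3, prod_encode (code Succ, list_encode [r]))"]
    by (intro cmp_intros)
  then have c: "cmp (\<lambda>n. code (const_rf n))" by (simp only: rec)
  have "cmp (\<lambda>v. code (?P v))"
    unfolding code.simps list.map by (intro cmp_intros cmp_comp[OF c] cmp_enc)
  with W show ?thesis by blast
qed

section \<open>An interpreter with finite oracle\<close>

type_synonym state = "(nat \<times> nat \<times> nat list) list \<times> nat list"

text \<open>A frame (tag, c, xs) asks for the evaluation of program c at xs (tag 0), or it waits for
  values on the stack in order to complete a composition (1), a primitive recursion (2) or a
  minimization (3). The absorbing frame with tag 4 is entered when the oracle string is too short
  or the code is invalid; this makes halting computations monotone in the oracle.\<close>

definition stuck :: state where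
  "stuck = ([(4, 0, [])], [])"

definition eval_step ::
  "bool list \<Rightarrow> nat \<Rightarrow> nat list \<Rightarrow> (nat \<times> nat \<times> nat list) list \<Rightarrow> nat list \<Rightarrow> state" where
  "eval_step \<tau> c xs fs vs = (case prod_decode c of (t, a) \<Rightarrow>
     if t = 0 then (fs, 0 # vs)
     else if t = 1 then (case xs of [] \<Rightarrow> stuck | x # _ \<Rightarrow> (fs, Suc x # vs))
     else if t = 2 then (case drop a xs of [] \<Rightarrow> stuck | x # _ \<Rightarrow> (fs, x # vs))
     else if t = 3 then
       (case prod_decode a of (f, gs) \<Rightarrow>
          (map (\<lambda>g. (0, g, xs)) (list_decode gs) @ (1, f, [length (list_decode gs)]) # fs, vs))
     else if t = 4 then
       (case prod_decode a of (f, g) \<Rightarrow>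
          case xs of [] \<Rightarrow> stuck
          | n # ys \<Rightarrow>
            (case n of 0 \<Rightarrow> ((0, f, ys) # fs, vs)
             | Suc m \<Rightarrow> ((0, c, m # ys) # (2, g, m # ys) # fs, vs)))
     else if t = 5 then ((0, a, 0 # xs) # (3, a, 0 # xs) # fs, vs)
     else if t = 6 then
       (case xs of [] \<Rightarrow> stuck
        | x # _ \<Rightarrow> (case drop x \<tau> of [] \<Rightarrow> stuck | b # _ \<Rightarrow> (fs, (if b then 1 else 0) # vs)))
     else stuck)"

definition step :: "bool list \<Rightarrow> state \<Rightarrow> state" where
  "step \<tau> s = (case s of (fs, vs) \<Rightarrow>
     case fs of [] \<Rightarrow> ([], vs)
     | fr # gs \<Rightarrow>
       (case fr of (t, p) \<Rightarrow> case p of (c, xs) \<Rightarrow>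
         if t = 0 then eval_step \<tau> c xs gs vs
         else if t = 1 then
           (case xs of [] \<Rightarrow> stuck | k # _ \<Rightarrow> ((0, c, rev (take k vs)) # gs, drop k vs))
         else if t = 2 then
           (case vs of [] \<Rightarrow> stuck | y # ws \<Rightarrow> ((0, c, y # xs) # gs, ws))
         else if t = 3 then
           (case xs of [] \<Rightarrow> stuck
            | n # ys \<Rightarrow>
              (case vs of [] \<Rightarrow> stuck
               | y # ws \<Rightarrow> if y = 0 then (gs, n # ws)
                   else ((0, c, Suc n # ys) # (3, c, Suc n # ys) # gs, ws)))
         else stuck))"

definition run :: "bool list \<Rightarrow> nat \<Rightarrow> state \<Rightarrow> state" where
  "run \<tau> k s = rec_nat s (\<lambda>_ r. step \<tau> r) k"

lemma run_0 [simp]: "run \<tau> 0 s = s"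
  and run_Suc: "run \<tau> (Suc k) s = step \<tau> (run \<tau> k s)"
  by (simp_all add: run_def)

lemma run_add: "run \<tau> (j + k) s = run \<tau> k (run \<tau> j s)"
  by (induction k) (simp_all add: run_Suc)

lemma run_halted: "run \<tau> k ([], vs) = ([], vs)"
  by (induction k) (auto simp: run_Suc step_def)

text \<open>The value 0 stands for divergence, and Suc y for convergence with output y.\<close>

definition interp :: "nat \<Rightarrow> nat list \<Rightarrow> bool list \<Rightarrow> nat" where
  "interp c xs \<tau> = (case run \<tau> (length \<tau>) ([(0, c, xs)], []) of (fs, vs) \<Rightarrow>
     case fs of [] \<Rightarrow> (case vs of [] \<Rightarrow> 0 | y # _ \<Rightarrow> Suc y) | _ # _ \<Rightarrow> 0)"

lemma cmp_eval_step:
  assumes "cmp \<tau>" "cmp c" "cmp xs" "cmp fs" "cmp vs"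
  shows "cmp (\<lambda>x. eval_step (\<tau> x) (c x) (xs x) (fs x) (vs x))"
proof -
  have "cmp (\<lambda>p. eval_step (fst p) (fst (snd p)) (fst (snd (snd p))) (fst (snd (snd (snd p))))
          (snd (snd (snd (snd p)))))"
    unfolding eval_step_def stuck_def by (intro cmp_intros)
  from cmp_comp[OF this, of "\<lambda>x. (\<tau> x, c x, xs x, fs x, vs x)"] show ?thesis
    by (simp add: assms cmp_Pair)
qed

lemma cmp_step:
  assumes "cmp \<tau>" "cmp s"
  shows "cmp (\<lambda>x. step (\<tau> x) (s x))"
proof -
  have "cmp (\<lambda>p. step (fst p) (snd p))"
    unfolding step_def stuck_def by (intro cmp_intros cmp_eval_step)
  from cmp_comp[OF this, of "\<lambda>x. (\<tau> x, s x)"] show ?thesis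
    by (simp add: assms cmp_Pair)
qed

lemma cmp_interp [cmp_intros]:
  assumes "cmp c" "cmp xs" "cmp \<tau>"
  shows "cmp (\<lambda>x. interp (c x) (xs x) (\<tau> x))"
proof -
  have "cmp (\<lambda>p. interp (fst p) (fst (snd p)) (snd (snd p)))"
    unfolding interp_def run_def by (intro cmp_intros cmp_step)
  from cmp_comp[OF this, of "\<lambda>x. (c x, xs x, \<tau> x)"] show ?thesis
    by (simp add: assms cmp_Pair)
qed

lemma step_stuck: "step \<tau> stuck = stuck"
  by (simp add: step_def stuck_def)

text \<open>Only the oracle instruction (tag 6) reads the string. A query inside the shorter string
  gets the same answer from the longer one, and a query beyond its end leads to
  \<open>stuck\<close>.\<close>

lemma eval_step_prefix:
  assumes "prefix \<tau> \<tau>'"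
  shows "eval_step \<tau> c xs fs vs = stuck \<or> eval_step \<tau> c xs fs vs = eval_step \<tau>' c xs fs vs"
proof -
  obtain t a where ta: "prod_decode c = (t, a)" by force
  have "drop x \<tau> = [] \<or> (\<exists>b ys zs. drop x \<tau> = b # ys \<and> drop x \<tau>' = b # zs)" for x
    using assms by (cases "drop x \<tau>") (auto simp: prefix_def)
  note D = this
  let ?o = "\<lambda>\<tau>. case xs of [] \<Rightarrow> stuck
      | x # _ \<Rightarrow> (case drop x \<tau> of [] \<Rightarrow> stuck | b # _ \<Rightarrow> (fs, (if b then 1 else 0) # vs))"
  have o: "?o \<tau> = stuck \<or> ?o \<tau> = ?o \<tau>'"
  proof (cases xs)
    case (Cons x ys)
    then show ?thesis using D[of x] by auto
  qed simp
  show ?thesis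
  proof (cases "t = 6")
    case True
    then have "eval_step \<sigma> c xs fs vs = ?o \<sigma>" for \<sigma> by (simp add: eval_step_def ta)
    then show ?thesis using o by simp
  next
    case False
    then show ?thesis by (simp add: eval_step_def ta)
  qed
qed

lemma step_prefix:
  assumes "prefix \<tau> \<tau>'"
  shows "step \<tau> s = stuck \<or> step \<tau> s = step \<tau>' s"
  using eval_step_prefix[OF assms] by (auto simp: step_def split: list.split prod.split)

lemma run_prefix:
  assumes "prefix \<tau> \<tau>'"
  shows "run \<tau> k s = stuck \<or> run \<tau> k s = run \<tau>' k s"
proof (induction k)
  case (Suc k)
  then show ?case
    using step_prefix[OF assms, of "run \<tau>' k s"] by (auto simp: run_Suc step_stuck)
qed simp

text \<open>The length of the string is both the available oracle and the number of steps. A run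
  that halts on the shorter string is repeated on the longer one, and the halted state then idles
  through the remaining steps.\<close>

lemma interp_prefix:
  assumes "prefix \<tau> \<tau>'" "interp c xs \<tau> \<noteq> 0"
  shows "interp c xs \<tau>' = interp c xs \<tau>"
proof -
  let ?s = "([(0, c, xs)], [])"
  obtain vs where vs: "run \<tau> (length \<tau>) ?s = ([], vs)"
    using assms(2) by (auto simp: interp_def split: prod.splits list.splits)
  then have "run \<tau>' (length \<tau>) ?s = ([], vs)"
    using run_prefix[OF assms(1), of "length \<tau>" ?s] by (auto simp: stuck_def)
  moreover have "length \<tau>' = length \<tau> + (length \<tau>' - length \<tau>)"
    using prefix_length_le[OF assms(1)] by simp
  ultimately have "run \<tau>' (length \<tau>') ?s = ([], vs)"
    by (metis run_add run_halted)
  with vs show ?thesis by (simp add: interp_def)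
qed

section \<open>Completeness of the interpreter on initial segments of an oracle\<close>

definition restr :: "nat set \<Rightarrow> nat \<Rightarrow> bool list" where
  "restr A l = map (\<lambda>i. i \<in> A) [0..<l]"

lemma length_restr [simp]: "length (restr A l) = l"
  by (simp add: restr_def)

lemma nth_restr [simp]: "i < l \<Longrightarrow> restr A l ! i \<longleftrightarrow> i \<in> A"
  by (simp add: restr_def)

lemma take_restr: "take k (restr A l) = restr A (min k l)"
  by (simp add: restr_def take_map min_def)

lemma prefix_restr: "k \<le> l \<Longrightarrow> prefix (restr A k) (restr A l)"
  by (metis min.absorb1 take_is_prefix take_restr)

text \<open>The number of steps is the same for all sufficiently long segments of the oracle; this
  makes the relation transitive by adding the numbers of steps.\<close>

definition reach :: "nat set \<Rightarrow> state \<Rightarrow> state \<Rightarrow> bool" where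
  "reach A s s' \<longleftrightarrow> (\<exists>k l. \<forall>l'\<ge>l. run (restr A l') k s = s')"

lemma reach_refl: "reach A s s"
  by (auto simp: reach_def intro!: exI[of _ 0])

lemma reach_trans: 
  assumes "reach A s s'" "reach A s' s''"
  shows "reach A s s''"
proof -
  obtain k l k' l' where "\<forall>m\<ge>l. run (restr A m) k s = s'" "\<forall>m\<ge>l'. run (restr A m) k' s' = s''"
    using assms unfolding reach_def by blast
  then have "\<forall>m\<ge>max l l'. run (restr A m) (k + k') s = s''"
    by (simp add: run_add)
  then show ?thesis unfolding reach_def by blast
qed

lemma reach_step: "(\<And>l'. l' \<ge> l \<Longrightarrow> step (restr A l') s = s') \<Longrightarrow> reach A s s'"
  unfolding reach_def by (rule exI[of _ 1], rule exI[of _ l]) (simp add: run_Suc)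

lemma reach_ev: "ev A p xs y \<Longrightarrow> reach A ((0, code p, xs) # fs, vs) (fs, y # vs)"
proof (induction arbitrary: fs vs rule: ev.induct)
  case (ev_Zero xs)
  show ?case by (rule reach_step[of 0]) (simp add: step_def eval_step_def)
next
  case (ev_Succ x xs)
  show ?case by (rule reach_step[of 0]) (simp add: step_def eval_step_def)
next
  case (ev_Proj i xs)
  then show ?case
    by (intro reach_step[of 0]) (simp add: step_def eval_step_def Cons_nth_drop_Suc[symmetric])
next
  case (ev_Comp xs gs ys f z)
  have "reach A (map (\<lambda>g. (0, code g, xs)) gs @ fs, vs) (fs, rev ys @ vs)" for fs vs
    using ev_Comp.IH(1)
  proof (induction arbitrary: vs rule: list_all2_induct)
    case Nil
    show ?case by (simp add: reach_refl)
  next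
    case (Cons g gs y ys)
    from Cons(1) have "reach A ((0, code g, xs) # map (\<lambda>g. (0, code g, xs)) gs @ fs, vs)
      (map (\<lambda>g. (0, code g, xs)) gs @ fs, y # vs)" by blast
    from reach_trans[OF this Cons.IH] show ?case by simp
  qed
  note args = this
  have len: "length gs = length ys"
    using ev_Comp.IH(1) by (rule list_all2_lengthD)
  have "reach A ((0, code (Comp f gs), xs) # fs, vs)
     (map (\<lambda>g. (0, code g, xs)) gs @ (1, code f, [length ys]) # fs, vs)"
    by (rule reach_step[of 0]) (simp add: step_def eval_step_def comp_def len)
  note r1 = reach_trans[OF this args]
  have r2: "reach A ((1, code f, [length ys]) # fs, rev ys @ vs) ((0, code f, ys) # fs, vs)"
    by (rule reach_step[of 0]) (simp add: step_def)
  show ?case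
    by (rule reach_trans[OF reach_trans[OF r1 r2] ev_Comp.IH(2)])
next
  case (ev_Prec0 f xs y g)
  have "reach A ((0, code (Prec f g), 0 # xs) # fs, vs) ((0, code f, xs) # fs, vs)"
    by (rule reach_step[of 0]) (simp add: step_def eval_step_def)
  from reach_trans[OF this ev_Prec0.IH] show ?case .
next
  case (ev_PrecS f g n xs y z)
  have "reach A ((0, code (Prec f g), Suc n # xs) # fs, vs)
     ((0, code (Prec f g), n # xs) # (2, code g, n # xs) # fs, vs)"
    by (rule reach_step[of 0]) (simp add: step_def eval_step_def)
  note r1 = reach_trans[OF this ev_PrecS.IH(1)]
  have r2: "reach A ((2, code g, n # xs) # fs, y # vs) ((0, code g, y # n # xs) # fs, vs)"
    by (rule reach_step[of 0]) (simp add: step_def)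
  show ?case by (rule reach_trans[OF reach_trans[OF r1 r2] ev_PrecS.IH(2)])
next
  case (ev_Mu f n xs)
  have "reach A ((0, code (Mu f), xs) # fs, vs)
      ((0, code f, m # xs) # (3, code f, m # xs) # fs, vs)" if "m \<le> n" for m
    using that
  proof (induction m)
    case 0
    show ?case by (rule reach_step[of 0]) (simp add: step_def eval_step_def)
  next
    case (Suc m)
    then obtain y where
      "\<And>fs vs. reach A ((0, code f, m # xs) # fs, vs) (fs, Suc y # vs)"
      using ev_Mu.IH(2) Suc_le_lessD by blast
    from reach_trans[OF Suc.IH this] Suc.prems
    have "reach A ((0, code (Mu f), xs) # fs, vs) ((3, code f, m # xs) # fs, Suc y # vs)"
      by simp
    moreover have "reach A ((3, code f, m # xs) # fs, Suc y # vs)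
      ((0, code f, Suc m # xs) # (3, code f, Suc m # xs) # fs, vs)"
      by (rule reach_step[of 0]) (simp add: step_def)
    ultimately show ?case by (rule reach_trans)
  qed
  note reach_trans[OF this[OF order_refl] ev_Mu.IH(1)]
  moreover have "reach A ((3, code f, n # xs) # fs, 0 # vs) (fs, n # vs)"
    by (rule reach_step[of 0]) (simp add: step_def)
  ultimately show ?case by (rule reach_trans)
next
  case (ev_Orc x xs)
  have "drop x (restr A l) = (x \<in> A) # drop (Suc x) (restr A l)" if "l \<ge> Suc x" for l
    using that by (simp add: Cons_nth_drop_Suc[symmetric])
  then show ?case
    by (intro reach_step[of "Suc x"]) (simp add: step_def eval_step_def)
qed

lemma interp_complete:
  assumes "ev A p xs y"
  obtains l where "\<And>m. m \<ge> l \<Longrightarrow> interp (code p) xs (restr A m) = Suc y"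
proof -
  from reach_ev[OF assms, of "[]" "[]"] obtain k l where
    kl: "\<forall>m\<ge>l. run (restr A m) k ([(0, code p, xs)], []) = ([], [y])"
    unfolding reach_def by blast
  have "interp (code p) xs (restr A m) = Suc y" if "m \<ge> max k l" for m
  proof -
    have "run (restr A m) (k + (m - k)) ([(0, code p, xs)], []) = ([], [y])"
      using kl that unfolding run_add by (simp add: run_halted)
    then show ?thesis using that by (simp add: interp_def)
  qed
  then show ?thesis by (rule that)
qed

text \<open>Soundness follows from completeness: a halting run keeps its output on all longer
  segments, and a long enough segment gives \<open>Suc y\<close>.\<close>

lemma interp_sound_total:
  assumes "ev A p xs y" "interp (code p) xs (restr A l) \<noteq> 0"
  shows "interp (code p) xs (restr A l) = Suc y"
proof -
  obtain l0 where "\<And>m. m \<ge> l0 \<Longrightarrow> interp (code p) xs (restr A m) = Suc y"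
    using interp_complete[OF assms(1)] by blast
  then have "interp (code p) xs (restr A (max l l0)) = Suc y" by simp
  with interp_prefix[OF prefix_restr assms(2), of "max l l0"] show ?thesis by simp
qed

section \<open>The construction\<close>

text \<open>Requirement prod_encode (e, n) with e = prod_encode (c, d) concerns the value at n of the
  limit of the functional with program c, under the bound on the number of changes given by d.\<close>

definition bval :: "nat \<Rightarrow> nat \<Rightarrow> nat" where
  "bval i s = (case prod_decode i of (e, n) \<Rightarrow> case prod_decode e of (c, d) \<Rightarrow>
     interp d [n] (replicate s False))"

text \<open>The stage bounds both the index and the declared number of values. So at most s + 1
  requirements are awake at stage s, each with at most s values, and a wake-up stage is a computable
  measure of later activity.\<close>

definition awake :: "nat \<Rightarrow> nat \<Rightarrow> bool" where
  "awake i s \<longleftrightarrow> i \<le> s \<and> 0 < bval i s \<and> bval i s \<le> s"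

text \<open>Stopping at the first approximation that has not yet converged makes the list grow only
  at its end when \<tau> is extended.\<close>

definition outs :: "nat \<Rightarrow> bool list \<Rightarrow> nat list" where
  "outs i \<tau> = (case prod_decode i of (e, n) \<Rightarrow> case prod_decode e of (c, d) \<Rightarrow>
     takeWhile (\<lambda>v. 0 < v) (map (\<lambda>t. interp c [n, t] \<tau>) [0..<length \<tau>]))"

text \<open>With at most b changes there are at most b + 1 entries after merging equal neighbours,
  and \<open>bval\<close>, once defined, is b + 1. So the cut loses nothing for an approximation
  that obeys its bound, and it imposes the bound on all others.\<close>

definition vals :: "nat \<Rightarrow> bool list \<Rightarrow> nat list" where
  "vals i \<tau> = take (bval i (length \<tau>)) (remdups_adj (outs i \<tau>))"

definition first_awake :: "nat \<Rightarrow> nat \<Rightarrow> bool" where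
  "first_awake i u \<longleftrightarrow> awake i u \<and> \<not> (\<exists>v. v < u \<and> awake i v)"

text \<open>Level m of the tree minds requirement i. Every time a requirement (e, m) with e \<le> m
  awakes, level m takes up all requirements that are awake by then; this happens at most
  m + 1 times.\<close>

definition minds :: "nat \<Rightarrow> nat \<Rightarrow> nat \<Rightarrow> bool" where
  "minds m s i \<longleftrightarrow>
     (\<exists>e. e < Suc m \<and> (\<exists>u. u < Suc s \<and> first_awake (prod_encode (e, m)) u \<and> awake i u))"

definition progress :: "nat \<Rightarrow> nat \<Rightarrow> bool list \<Rightarrow> nat" where
  "progress m s \<tau> = (\<Sum>i<Suc s. if minds m s i then length (vals i \<tau>) else 0)"

text \<open>A map of the full binary tree that shifts the cone above \<rho> into the cone above
  \<open>\<rho> @ \<mu>\<close> and fixes everything else. Precomposing a tree with it moves the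
  node at \<rho> to the node formerly at \<open>\<rho> @ \<mu>\<close>.\<close>

definition ins :: "bool list \<Rightarrow> bool list \<Rightarrow> bool list \<Rightarrow> bool list" where
  "ins \<rho> \<mu> \<sigma> = (if prefix \<rho> \<sigma> then \<rho> @ \<mu> @ drop (length \<rho>) \<sigma> else \<sigma>)"

text \<open>The first component of the stage is a counter that makes every pair of strings recur at
  arbitrarily late stages.\<close>

definition cand :: "nat \<Rightarrow> bool list \<times> bool list" where
  "cand s = (case prod_decode (snd (prod_decode s)) of (a, b) \<Rightarrow>
     (map (\<lambda>v. 0 < v) (list_decode a), map (\<lambda>v. 0 < v) (list_decode b)))"

text \<open>The newest move is the head of the list and is applied first. A move therefore
  precomposes the old tree, which makes the new tree a subtree.\<close>

definition emb :: "(bool list \<times> bool list) list \<Rightarrow> bool list \<Rightarrow> bool list" where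
  "emb H \<sigma> = fold (\<lambda>p \<sigma>. ins (fst p) (snd p) \<sigma>) H \<sigma>"

definition gains :: "nat \<Rightarrow> (bool list \<times> bool list) list \<Rightarrow> bool" where
  "gains s H \<longleftrightarrow>
     progress (length (fst (cand s))) s (emb H (fst (cand s)))
     < progress (length (fst (cand s))) s (emb H (fst (cand s) @ snd (cand s)))"

definition moves :: "nat \<Rightarrow> (bool list \<times> bool list) list" where
  "moves = rec_nat [] (\<lambda>s H. if gains s H then cand s # H else H)"

definition tree :: "nat \<Rightarrow> bool list \<Rightarrow> bool list" where
  "tree s \<sigma> = emb (moves s) \<sigma>"

section \<open>Computability of the construction\<close>

lemma cmp_bval [cmp_intros]: "cmp f \<Longrightarrow> cmp g \<Longrightarrow> cmp (\<lambda>x. bval (f x) (g x))"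
  unfolding bval_def case_prod_beta by (intro cmp_intros)

lemma cmp_awake [cmp_intros]: "cmp f \<Longrightarrow> cmp g \<Longrightarrow> cmp (\<lambda>x. awake (f x) (g x))"
  unfolding awake_def by (intro cmp_intros)

lemma cmp_vals [cmp_intros]:
  assumes "cmp f" "cmp g" shows "cmp (\<lambda>x. vals (f x) (g x))"
proof -
  have "cmp (\<lambda>p. vals (fst p) (snd p))"
    unfolding vals_def outs_def by (intro cmp_intros)
  from cmp_comp[OF this, of "\<lambda>x. (f x, g x)"] show ?thesis
    by (simp add: assms cmp_Pair)
qed

lemma cmp_minds [cmp_intros]:
  assumes "cmp f" "cmp g" "cmp h" shows "cmp (\<lambda>x. minds (f x) (g x) (h x))"
proof -
  have "cmp (\<lambda>p. minds (fst p) (fst (snd p)) (snd (snd p)))"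
    unfolding minds_def first_awake_def by (intro cmp_intros)
  from cmp_comp[OF this, of "\<lambda>x. (f x, g x, h x)"] show ?thesis
    by (simp add: assms cmp_Pair)
qed

lemma cmp_progress [cmp_intros]:
  assumes "cmp f" "cmp g" "cmp h" shows "cmp (\<lambda>x. progress (f x) (g x) (h x))"
proof -
  have "cmp (\<lambda>p. progress (fst p) (fst (snd p)) (snd (snd p)))"
    unfolding progress_def by (intro cmp_intros)
  from cmp_comp[OF this, of "\<lambda>x. (f x, g x, h x)"] show ?thesis
    by (simp add: assms cmp_Pair)
qed

lemma cmp_emb [cmp_intros]:
  assumes "cmp f" "cmp g" shows "cmp (\<lambda>x. emb (f x) (g x))"
  unfolding emb_def ins_def by (intro cmp_intros assms)

lemma cmp_cand [cmp_intros]: "cmp f \<Longrightarrow> cmp (\<lambda>x. cand (f x))"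
  unfolding cand_def by (intro cmp_intros)

lemma cmp_gains [cmp_intros]:
  assumes "cmp f" "cmp g" shows "cmp (\<lambda>x. gains (f x) (g x))"
  unfolding gains_def by (intro cmp_intros assms)

lemma cmp_tree [cmp_intros]:
  assumes "cmp f" "cmp g" shows "cmp (\<lambda>x. tree (f x) (g x))"
  unfolding tree_def moves_def by (intro cmp_intros assms)

section \<open>Monotonicity of values, wake-ups and progress\<close>

lemma restr_empty: "replicate s False = restr {} s"
  by (simp add: restr_def map_replicate_const)

lemma bval_eq: "s \<le> t \<Longrightarrow> bval i s \<noteq> 0 \<Longrightarrow> bval i t = bval i s"
  unfolding bval_def restr_empty
  by (auto simp: prefix_restr interp_prefix split: prod.splits)

lemma bval_cases: "bval i s = 0 \<or> bval i t = 0 \<or> bval i s = bval i t"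
  by (metis bval_eq nat_le_linear)

lemma awake_mono: "awake i s \<Longrightarrow> s \<le> t \<Longrightarrow> awake i t"
  unfolding awake_def using bval_eq[of s t i] by auto

lemma length_vals_le: "awake i s \<Longrightarrow> length (vals i \<tau>) \<le> s"
  using bval_cases[of i s "length \<tau>"] by (auto simp: awake_def vals_def)

lemma prefix_remdups_adj: "prefix xs ys \<Longrightarrow> prefix (remdups_adj xs) (remdups_adj ys)"
proof (cases xs rule: rev_cases)
  case (snoc zs z)
  assume "prefix xs ys"
  then obtain ws where "ys = zs @ z # ws" using snoc by (auto simp: prefix_def)
  then show ?thesis using remdups_adj_append[of zs z ws] snoc by simp
qed simp

lemma prefix_takeWhile_upt:
  assumes "\<And>t. P (f t) \<Longrightarrow> g t = f t" "k \<le> l"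
  shows "prefix (takeWhile P (map f [0..<k])) (takeWhile P (map g [0..<l]))"
  using assms(2)
proof (induction k)
  case (Suc k)
  show ?case
  proof (cases "\<forall>t\<le>k. P (f t)")
    case True
    then have t: "takeWhile P (map f [0..<Suc k]) = map g [0..<Suc k]"
      using assms(1) by (subst takeWhile_eq_all_conv[THEN iffD2]) (auto simp: less_Suc_eq_le)
    have "map g [0..<l] = map g [0..<Suc k] @ map g [Suc k..<l]"
      using Suc.prems by (metis le_add_diff_inverse map_append upt_add_eq_append zero_le)
    moreover have "\<forall>y\<in>set (map g [0..<Suc k]). P y"
      using True assms(1) by (auto simp: less_Suc_eq_le)
    ultimately have "takeWhile P (map g [0..<l])
        = map g [0..<Suc k] @ takeWhile P (map g [Suc k..<l])"
      by (simp only: takeWhile_append2)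
    then show ?thesis unfolding t by (simp only: prefixI)
  next
    case False
    then have "takeWhile P (map f [0..<Suc k]) = takeWhile P (map f [0..<k])"
      by (cases "\<forall>t<k. P (f t)")
        (auto simp: takeWhile_append less_Suc_eq_le le_less takeWhile_eq_all_conv[THEN iffD2])
    then show ?thesis using Suc by simp
  qed
qed simp

lemma prefix_outs:
  assumes "prefix \<tau> \<tau>'" shows "prefix (outs i \<tau>) (outs i \<tau>')"
  unfolding outs_def case_prod_beta
  by (rule prefix_takeWhile_upt) (auto simp: interp_prefix[OF assms] prefix_length_le[OF assms])

lemma prefix_take_mono: "prefix xs ys \<Longrightarrow> prefix (take n xs) (take n ys)"
  by (auto simp: prefix_def)

lemma prefix_vals:
  assumes "prefix \<tau> \<tau>'" shows "prefix (vals i \<tau>) (vals i \<tau>')"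
proof (cases "bval i (length \<tau>) = 0")
  case False
  then have "bval i (length \<tau>') = bval i (length \<tau>)"
    by (rule bval_eq[OF prefix_length_le[OF assms]])
  then show ?thesis
    unfolding vals_def using prefix_take_mono[OF prefix_remdups_adj[OF prefix_outs[OF assms]]] by simp
qed (simp add: vals_def)

lemma length_vals_mono: "prefix \<tau> \<tau>' \<Longrightarrow> length (vals i \<tau>) \<le> length (vals i \<tau>')"
  by (rule prefix_length_le[OF prefix_vals])

lemma minds_awake: "minds m s i \<Longrightarrow> awake i s"
  unfolding minds_def using awake_mono less_Suc_eq_le by blast

lemma minds_le: "minds m s i \<Longrightarrow> i \<le> s"
  using minds_awake awake_def by blast

lemma minds_mono: "minds m s i \<Longrightarrow> s \<le> t \<Longrightarrow> minds m t i"
  unfolding minds_def by (meson Suc_le_mono less_le_trans)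

lemma first_awake_unique: "first_awake i u \<Longrightarrow> first_awake i v \<Longrightarrow> u = v"
  unfolding first_awake_def by (metis linorder_neqE_nat)

lemma ex_first_awake: "awake i s \<Longrightarrow> \<exists>u\<le>s. first_awake i u"
  unfolding first_awake_def by (metis (no_types, lifting) LeastI Least_le not_less_Least)

lemma minds_eventually_const: "\<exists>s0. \<forall>s\<ge>s0. minds m s = minds m s0"
proof -
  let ?U = "{u. \<exists>e<Suc m. first_awake (prod_encode (e, m)) u}"
  have "?U = (\<Union>e<Suc m. {u. first_awake (prod_encode (e, m)) u})" by auto
  moreover have "finite {u. first_awake i u}" for i
  proof (cases "\<exists>u. first_awake i u")
    case True
    then obtain u where "first_awake i u" by blast
    then have "{u. first_awake i u} = {u}" using first_awake_unique by blast
    then show ?thesis by simp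
  qed simp
  ultimately have "finite ?U" by simp
  then obtain s0 where s0: "\<forall>u\<in>?U. u \<le> s0" using finite_nat_set_iff_bounded_le by blast
  have "minds m s i = minds m s0 i" if "s \<ge> s0" for s i
    using s0 that unfolding minds_def less_Suc_eq_le by (auto, meson le_trans)
  then show ?thesis by blast
qed

text \<open>All minded indices are at most the stage, so the cutoff of the sum disappears and
  progress depends on the stage only through the set of minded requirements.\<close>

lemma progress_eq: "progress m s \<tau> = (\<Sum>i | minds m s i. length (vals i \<tau>))"
  unfolding progress_def
  by (subst sum.inter_filter[symmetric]) (auto intro!: sum.cong dest: minds_le simp: less_Suc_eq_le)

lemma progress_cong:
  assumes "minds m s = minds m t"
  shows "progress m s \<tau> = progress m t \<tau>"
  using assms by (simp add: progress_eq)

lemma progress_mono: "prefix \<tau> \<tau>' \<Longrightarrow> progress m s \<tau> \<le> progress m s \<tau>'"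
  unfolding progress_def by (intro sum_mono) (auto intro: length_vals_mono)

lemma progress_less:
  assumes "prefix \<tau> \<tau>'" "minds m s i" "length (vals i \<tau>) < length (vals i \<tau>')"
  shows "progress m s \<tau> < progress m s \<tau>'"
  unfolding progress_def
proof (rule sum_strict_mono_ex1)
  show "\<exists>i\<in>{..<Suc s}. (if minds m s i then length (vals i \<tau>) else 0)
      < (if minds m s i then length (vals i \<tau>') else 0)"
    using assms(2,3) minds_le[OF assms(2)] by (intro bexI[of _ i]) auto
qed (auto intro: length_vals_mono[OF assms(1)])

text \<open>Being awake at t limits the indices to t + 1 many and the values of each to t.\<close>

lemma progress_le: 
  assumes "\<And>i. minds m s i \<Longrightarrow> awake i t" shows "progress m s \<tau> \<le> Suc t * t"
proof -
  have "progress m s \<tau> \<le> card {i. minds m s i} * t"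
    using sum_bounded_above[of "{i. minds m s i}" "\<lambda>i. length (vals i \<tau>)" t]
    by (auto intro: length_vals_le assms simp: progress_eq)
  also have "card {i. minds m s i} \<le> card {..t}"
    by (intro card_mono) (auto dest!: assms simp: awake_def)
  finally show ?thesis by (simp add: mult_le_mono1)
qed

section \<open>Moves as embeddings of the binary tree\<close>

lemma ins_prefix: "prefix \<sigma> \<sigma>' \<Longrightarrow> prefix (ins \<rho> \<mu> \<sigma>) (ins \<rho> \<mu> \<sigma>')"
proof (cases "prefix \<rho> \<sigma>")
  case True
  assume "prefix \<sigma> \<sigma>'"
  with True show ?thesis by (auto simp: ins_def prefix_def)
next
  case False
  assume *: "prefix \<sigma> \<sigma>'"
  with False show ?thesis
    by (cases "prefix \<rho> \<sigma>'") (auto simp: ins_def dest: prefix_same_cases)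
qed

lemma length_ins: "length \<sigma> \<le> length (ins \<rho> \<mu> \<sigma>)"
  by (auto simp: ins_def prefix_def)

lemma ins_not_prefix:
  assumes "\<sigma> \<parallel> \<tau>" shows "\<not> prefix (ins \<rho> \<mu> \<sigma>) (ins \<rho> \<mu> \<tau>)"
proof
  assume p: "prefix (ins \<rho> \<mu> \<sigma>) (ins \<rho> \<mu> \<tau>)"
  show False
  proof (cases "prefix \<rho> \<sigma>"; cases "prefix \<rho> \<tau>")
    assume "prefix \<rho> \<sigma>" "prefix \<rho> \<tau>"
    with p assms show False by (auto simp: ins_def prefix_def parallel_def)
  next
    assume "prefix \<rho> \<sigma>" "\<not> prefix \<rho> \<tau>"
    with p show False by (auto simp: ins_def dest: append_prefixD)
  next
    assume 1: "\<not> prefix \<rho> \<sigma>" "prefix \<rho> \<tau>"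
    with p have "prefix \<sigma> (\<rho> @ \<mu> @ drop (length \<rho>) \<tau>)" by (simp add: ins_def)
    then have "prefix \<sigma> \<rho> \<or> prefix \<rho> \<sigma>" by (rule prefix_same_cases) simp
    with 1 assms show False by (auto simp: parallel_def intro: prefix_order.trans)
  next
    assume "\<not> prefix \<rho> \<sigma>" "\<not> prefix \<rho> \<tau>"
    with p assms show False by (simp add: ins_def parallel_def)
  qed
qed

lemma emb_Cons: "emb (p # H) \<sigma> = emb H (ins (fst p) (snd p) \<sigma>)"
  by (simp add: emb_def)

lemma emb_prefix: "prefix \<sigma> \<sigma>' \<Longrightarrow> prefix (emb H \<sigma>) (emb H \<sigma>')"
proof (induction H arbitrary: \<sigma> \<sigma>')
  case (Cons p H)
  then show ?case by (simp add: emb_Cons ins_prefix)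
qed (simp add: emb_def)

lemma length_emb: "length \<sigma> \<le> length (emb H \<sigma>)"
proof (induction H arbitrary: \<sigma>)
  case (Cons p H)
  then show ?case using length_ins le_trans unfolding emb_Cons by blast
qed (simp add: emb_def)

lemma emb_parallel: "\<sigma> \<parallel> \<tau> \<Longrightarrow> emb H \<sigma> \<parallel> emb H \<tau>"
proof (induction H arbitrary: \<sigma> \<tau>)
  case (Cons p H)
  then have "ins (fst p) (snd p) \<sigma> \<parallel> ins (fst p) (snd p) \<tau>"
    using ins_not_prefix parallel_commute unfolding parallel_def by blast
  then show ?case unfolding emb_Cons by (rule Cons.IH)
qed (simp add: emb_def)

lemma tree_prefix: "prefix \<sigma> \<sigma>' \<Longrightarrow> prefix (tree s \<sigma>) (tree s \<sigma>')"
  unfolding tree_def by (rule emb_prefix)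

lemma length_tree: "length \<sigma> \<le> length (tree s \<sigma>)"
  unfolding tree_def by (rule length_emb)

lemma tree_parallel: "\<sigma> \<parallel> \<tau> \<Longrightarrow> tree s \<sigma> \<parallel> tree s \<tau>"
  unfolding tree_def by (rule emb_parallel)

definition acts :: "nat \<Rightarrow> bool" where
  "acts s \<longleftrightarrow> gains s (moves s)"

lemma tree_Suc:
  "tree (Suc s) \<sigma> = (if acts s then tree s (ins (fst (cand s)) (snd (cand s)) \<sigma>) else tree s \<sigma>)"
  by (simp add: tree_def moves_def acts_def emb_Cons)

text \<open>The trees are nested: each move precomposes with \<open>ins\<close>, which never
  shortens a string.\<close>

lemma tree_later: "s \<le> t \<Longrightarrow> \<exists>\<sigma>'. tree t \<sigma> = tree s \<sigma>' \<and> length \<sigma> \<le> length \<sigma>'"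
proof (induction t arbitrary: \<sigma> rule: dec_induct)
  case (step t)
  show ?case
    using step.IH length_ins le_trans unfolding tree_Suc by (metis (no_types, lifting))
qed auto

lemma tree_Suc_same:
  assumes "\<not> acts s \<or> length \<sigma> \<le> length (fst (cand s))" "acts s \<Longrightarrow> \<sigma> \<noteq> fst (cand s)"
  shows "tree (Suc s) \<sigma> = tree s \<sigma>"
  using assms by (auto simp: tree_Suc ins_def prefix_def)

lemma tree_Suc_cand: "acts s \<Longrightarrow> tree (Suc s) (fst (cand s)) = tree s (fst (cand s) @ snd (cand s))"
  by (simp add: tree_Suc ins_def)

text \<open>A move injures only levels higher than its own. On its own level it replaces the single
  node at the candidate by an extension.\<close>

lemma tree_Suc_prefix:
  assumes "\<not> acts s \<or> length \<sigma> \<le> length (fst (cand s))"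
  shows "prefix (tree s \<sigma>) (tree (Suc s) \<sigma>)"
proof (cases "acts s \<and> \<sigma> = fst (cand s)")
  case True
  then show ?thesis by (simp add: tree_Suc_cand tree_prefix)
next
  case False
  then show ?thesis using tree_Suc_same[OF assms] by simp
qed

lemma acts_iff: "acts s \<longleftrightarrow> progress (length (fst (cand s))) s (tree s (fst (cand s)))
    < progress (length (fst (cand s))) s (tree s (fst (cand s) @ snd (cand s)))"
  by (simp add: acts_def gains_def tree_def)

lemma acts_progress:
  "acts s \<Longrightarrow> progress (length (fst (cand s))) s (tree s (fst (cand s)))
    < progress (length (fst (cand s))) s (tree (Suc s) (fst (cand s)))"
  by (simp add: tree_Suc_cand) (simp add: acts_iff)

lemma cand_recurs: "\<exists>s\<ge>s0. cand s = (\<rho>, \<mu>)"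
proof -
  let ?e = "\<lambda>\<sigma>. list_encode (map of_bool \<sigma>)"
  let ?s = "prod_encode (s0, prod_encode (?e \<rho>, ?e \<mu>))"
  have "map (\<lambda>v. (0::nat) < v) (map of_bool \<sigma>) = \<sigma>" for \<sigma>
    by (induction \<sigma>) auto
  then have "cand ?s = (\<rho>, \<mu>)" by (simp add: cand_def)
  then show ?thesis using le_prod_encode_1 by blast
qed

lemma bounded_mono_eventually_const:
  fixes c :: "nat \<Rightarrow> nat"
  assumes "\<And>s. s \<ge> s0 \<Longrightarrow> c s \<le> c (Suc s)" "\<And>s. c s \<le> B"
  shows "\<exists>s1\<ge>s0. \<forall>s\<ge>s1. c s = c s1"
proof -
  have fin: "finite (c ` {s0..})" by (rule finite_subset[of _ "{..B}"]) (auto simp: assms(2))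
  then have "Max (c ` {s0..}) \<in> c ` {s0..}" by (intro Max_in) auto
  then obtain s1 where s1: "s1 \<ge> s0" "c s1 = Max (c ` {s0..})" by auto
  have "c s = c s1" if "s \<ge> s1" for s
  proof (rule antisym)
    show "c s \<le> c s1" using fin s1 that by simp
    show "c s1 \<le> c s" using that
    proof (induction s rule: dec_induct)
      case (step t)
      then show ?case using assms(1)[of t] s1(1) by linarith
    qed simp
  qed
  then show ?thesis using s1(1) by blast
qed

section \<open>Convergence of the trees\<close>

definition settled :: "nat \<Rightarrow> bool list \<Rightarrow> bool" where
  "settled s \<sigma> \<longleftrightarrow> (\<forall>t\<ge>s. tree t \<sigma> = tree s \<sigma>)"

lemma settled_mono: "settled s \<sigma> \<Longrightarrow> s \<le> t \<Longrightarrow> settled t \<sigma>"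
  unfolding settled_def by (metis le_trans)

lemma settled_eq: "settled s \<sigma> \<Longrightarrow> s \<le> t \<Longrightarrow> tree t \<sigma> = tree s \<sigma>"
  unfolding settled_def by blast

lemma settled_eq2: "settled s0 \<sigma> \<Longrightarrow> s0 \<le> s \<Longrightarrow> s0 \<le> t \<Longrightarrow> tree s \<sigma> = tree t \<sigma>"
  unfolding settled_def by metis

lemma ex_settled_finite:
  assumes "finite F" "\<And>\<sigma>. \<sigma> \<in> F \<Longrightarrow> \<exists>s. settled s \<sigma>"
  shows "\<exists>s. \<forall>\<sigma>\<in>F. settled s \<sigma>"
  using assms
proof (induction F)
  case (insert x F)
  then obtain s where "\<forall>\<sigma>\<in>F. settled s \<sigma>" by blast
  moreover obtain t where "settled t x" using insert.prems by blast
  ultimately have "\<forall>\<sigma>\<in>insert x F. settled (max s t) \<sigma>"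
    by (auto intro: settled_mono)
  then show ?case by blast
qed simp

text \<open>Finite injury by induction on the length. A move strictly increases the progress at its
  candidate, so none can occur at a settled proper prefix. Afterwards the node changes only by moves
  at \<sigma> itself, each of which raises a bounded quantity.\<close>

lemma ex_settled: "\<exists>s. settled s \<sigma>"
proof (induction "length \<sigma>" arbitrary: \<sigma> rule: less_induct)
  case less
  have "finite {\<rho>. strict_prefix \<rho> \<sigma>}"
    by (rule finite_subset[of _ "set (prefixes \<sigma>)"]) (auto simp: in_set_prefixes)
  then have "\<exists>s. \<forall>\<rho>\<in>{\<rho>. strict_prefix \<rho> \<sigma>}. settled s \<rho>"
    by (rule ex_settled_finite) (simp add: less prefix_length_less)
  then obtain s1 where s1: "\<And>\<rho>. strict_prefix \<rho> \<sigma> \<Longrightarrow> settled s1 \<rho>" by blast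
  let ?m = "length \<sigma>"
  obtain s2 where s2: "\<forall>s\<ge>s2. minds ?m s = minds ?m s2"
    using minds_eventually_const by blast
  let ?s = "max s1 s2" and ?c = "\<lambda>s. progress ?m s2 (tree s \<sigma>)"
  have prog: "progress ?m s \<tau> = progress ?m s2 \<tau>" if "s \<ge> ?s" for s \<tau>
    using that by (intro progress_cong s2[rule_format]) simp
  have progr: "tree (Suc s) \<sigma> = tree s \<sigma> \<or> ?c s < ?c (Suc s)" if s: "s \<ge> ?s" for s
  proof (cases "acts s \<and> prefix (fst (cand s)) \<sigma>")
    case True
    have "\<not> strict_prefix (fst (cand s)) \<sigma>"
    proof
      assume "strict_prefix (fst (cand s)) \<sigma>"
      then have "tree (Suc s) (fst (cand s)) = tree s (fst (cand s))"
        using settled_eq2[OF s1, of _ "Suc s" s] s by simp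
      with acts_progress[of s] True show False by simp
    qed
    with True have "fst (cand s) = \<sigma>" by (simp add: strict_prefix_def)
    with acts_progress[of s] True prog[OF s] show ?thesis by simp
  next
    case False
    then show ?thesis by (auto simp: tree_Suc ins_def)
  qed
  have B: "?c s \<le> Suc s2 * s2" for s
    by (rule progress_le) (rule minds_awake)
  have mono: "?c s \<le> ?c (Suc s)" if "s \<ge> ?s" for s
    using progr[OF that] by auto
  from bounded_mono_eventually_const[of ?s ?c, OF mono B]
  obtain s3 where s3: "s3 \<ge> ?s" "\<forall>s\<ge>s3. ?c s = ?c s3" by blast
  have "tree s \<sigma> = tree s3 \<sigma>" if "s \<ge> s3" for s
    using that
  proof (induction s rule: dec_induct)
    case (step t)
    note IH = step.IH
    have "?c (Suc t) = ?c t" using s3(2)[rule_format, of t] s3(2)[rule_format, of "Suc t"] \<open>s3 \<le> t\<close> by simp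
    with progr[of t] \<open>s3 \<le> t\<close> s3(1) have "tree (Suc t) \<sigma> = tree t \<sigma>" by simp
    with IH show ?case by simp
  qed simp
  then show ?case unfolding settled_def by blast
qed

fun strs :: "nat \<Rightarrow> bool list list" where
  "strs 0 = [[]]"
| "strs (Suc k) = concat (map (\<lambda>\<sigma>. [False # \<sigma>, True # \<sigma>]) (strs k))"

lemma set_strs: "set (strs k) = {\<sigma>. length \<sigma> = k}"
proof (induction k)
  case (Suc k)
  have "b # \<sigma> \<in> set (strs (Suc k)) \<longleftrightarrow> length \<sigma> = k" for b \<sigma>
    using Suc by (cases b) auto
  moreover have "[] \<notin> set (strs (Suc k))" by auto
  ultimately have "\<sigma> \<in> set (strs (Suc k)) \<longleftrightarrow> length \<sigma> = Suc k" for \<sigma>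
    by (cases \<sigma>) auto
  then show ?case by blast
qed simp

lemma finite_level: "finite {\<sigma> :: bool list. length \<sigma> = k}"
  using finite_set[of "strs k"] by (simp only: set_strs)

lemma length_strs: "length (strs k) = 2 ^ k"
  by (induction k) (auto simp: length_concat comp_def sum_list_const_mult sum_list_triv)

lemma cmp_strs [cmp_intros]: 
  assumes "cmp f" shows "cmp (\<lambda>x. strs (f x))"
proof -
  have "rec_nat [[]] (\<lambda>_ L. concat (map (\<lambda>\<sigma>. [False # \<sigma>, True # \<sigma>]) L)) k = strs k" for k
    by (induction k) auto
  moreover have "cmp (\<lambda>x. rec_nat [[]] (\<lambda>_ L. concat (map (\<lambda>\<sigma>. [False # \<sigma>, True # \<sigma>]) L)) (f x))"
    by (intro cmp_intros assms)
  ultimately show ?thesis by simp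
qed

lemma ex_settled_level: "\<exists>s\<ge>s0. \<forall>\<sigma>. length \<sigma> = k \<longrightarrow> settled s \<sigma>"
proof -
  have "\<exists>s. \<forall>\<sigma>\<in>{\<sigma>. length \<sigma> = k}. settled s \<sigma>"
    by (rule ex_settled_finite[OF finite_level ex_settled])
  then obtain s where s: "\<And>\<sigma>. length \<sigma> = k \<Longrightarrow> settled s \<sigma>" by blast
  show ?thesis
    by (rule exI[of _ "max s s0"]) (simp add: settled_mono[OF s])
qed

section \<open>The class\<close>

definition along :: "nat set \<Rightarrow> bool list \<Rightarrow> bool" where
  "along X \<tau> \<longleftrightarrow> \<tau> = restr X (length \<tau>)"

text \<open>The initial segment of length s is tested against the tree of stage s only, which keeps
  the condition decidable; the nesting of the trees makes the members paths through all of
  them.\<close>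

definition tree_class :: "nat set set" where
  "tree_class = {X. \<forall>s. \<exists>\<sigma>. length \<sigma> = s \<and> prefix (restr X s) (tree s \<sigma>)}"

lemma along_restr [simp]: "along X (restr X l)"
  by (simp add: along_def)

lemma along_prefix: "along X \<tau> \<Longrightarrow> prefix \<tau>' \<tau> \<Longrightarrow> along X \<tau>'"
proof -
  assume "along X \<tau>" "prefix \<tau>' \<tau>"
  then obtain ws where ws: "restr X (length \<tau>) = \<tau>' @ ws"
    by (metis along_def prefix_def)
  have "\<tau>' = take (length \<tau>') (restr X (length \<tau>))" by (simp add: ws)
  moreover have "length \<tau>' \<le> length \<tau>" by (rule prefix_length_le) fact
  ultimately show ?thesis by (simp add: along_def take_restr min_absorb1)
qed

lemma along_prefix_iff: "along X \<tau> \<Longrightarrow> along X \<tau>' \<Longrightarrow> length \<tau> \<le> length \<tau>' \<Longrightarrow> prefix \<tau> \<tau>'"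
  unfolding along_def by (metis prefix_restr)

lemma tree_class_along:
  assumes "X \<in> tree_class"
  obtains \<rho> where "length \<rho> = k" "along X (tree s \<rho>)"
proof -
  \<comment> \<open>At this stage the segment of \<open>X\<close> under test is longer than every
    node of level \<open>k\<close> in the tree of stage \<open>s\<close>, so it contains the one
    below it completely.\<close>
  let ?t = "s + k + (\<Sum>\<rho>\<in>set (strs k). length (tree s \<rho>))"
  obtain \<sigma> where \<sigma>: "length \<sigma> = ?t" "prefix (restr X ?t) (tree ?t \<sigma>)"
    using assms unfolding tree_class_def by blast
  obtain \<sigma>' where \<sigma>': "tree ?t \<sigma> = tree s \<sigma>'" "length \<sigma> \<le> length \<sigma>'"
    using tree_later[of s ?t \<sigma>] by auto
  let ?\<rho> = "take k \<sigma>'"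
  have len: "length ?\<rho> = k" using \<sigma>(1) \<sigma>'(2) by simp
  then have "length (tree s ?\<rho>) \<le> (\<Sum>\<rho>\<in>set (strs k). length (tree s \<rho>))"
    by (intro member_le_sum) (simp_all only: set_strs mem_Collect_eq finite_level le0)
  moreover have "prefix (tree s ?\<rho>) (tree s \<sigma>')" by (intro tree_prefix take_is_prefix)
  ultimately have "prefix (tree s ?\<rho>) (restr X ?t)"
    using \<sigma>(2) unfolding \<sigma>'(1) by (intro prefix_length_prefix[of _ _ "restr X ?t"]) auto
  then show ?thesis using that len along_prefix along_restr by blast
qed

lemma along_tree_prefix:
  assumes "along X (tree s \<rho>)" "along X (tree s \<sigma>)" "length \<rho> \<le> length \<sigma>"
  shows "prefix \<rho> \<sigma>"
proof (rule ccontr)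
  assume not: "\<not> prefix \<rho> \<sigma>"
  have "\<not> prefix \<sigma> \<rho>"
  proof
    assume "prefix \<sigma> \<rho>"
    with assms(3) have "\<sigma> = \<rho>"
      by (metis append_eq_conv_conj prefix_def take_all)
    with not show False by simp
  qed
  with not have "tree s \<rho> \<parallel> tree s \<sigma>" by (intro tree_parallel) auto
  then show False
    using along_prefix_iff[OF assms(1,2)] along_prefix_iff[OF assms(2,1)] nat_le_linear
    by (auto simp: parallel_def)
qed

text \<open>A string on the path that improved the values of i would be picked as a candidate at some
  late stage, and the tree would move.\<close>

lemma vals_maximal:
  assumes X: "X \<in> tree_class" and stab: "settled s0 \<rho>" and minds: "minds (length \<rho>) s0 i"
    and al: "along X (tree s0 \<rho>)"
  shows "length (vals i (restr X t)) \<le> length (vals i (tree s0 \<rho>))"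
proof (rule ccontr)
  assume less: "\<not> ?thesis"
  let ?k = "length \<rho>"
  obtain s1 where s1: "s1 \<ge> s0" "\<And>\<sigma>. length \<sigma> = ?k + t \<Longrightarrow> settled s1 \<sigma>"
    using ex_settled_level[of s0 "?k + t"] by blast
  obtain \<sigma> where \<sigma>: "length \<sigma> = ?k + t" "along X (tree s1 \<sigma>)"
    using tree_class_along[OF X] by blast
  have "prefix \<rho> \<sigma>"
    using along_tree_prefix[of X s1 \<rho> \<sigma>] \<sigma> al settled_eq[OF stab s1(1)] by simp
  then obtain \<mu> where \<mu>: "\<sigma> = \<rho> @ \<mu>" by (auto simp: prefix_def)
  obtain s where s: "s \<ge> s1" "cand s = (\<rho>, \<mu>)" using cand_recurs by blast
  have eqs: "tree s \<rho> = tree s0 \<rho>" "tree (Suc s) \<rho> = tree s0 \<rho>" "tree s \<sigma> = tree s1 \<sigma>"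
    using s(1) s1(1) by (auto intro: settled_eq[OF stab] settled_eq[OF s1(2)[OF \<sigma>(1)]])
  have "length (restr X t) \<le> length (tree s1 \<sigma>)"
    using length_tree[of \<sigma> s1] \<sigma>(1) by simp
  then have "prefix (restr X t) (tree s1 \<sigma>)"
    using along_prefix_iff \<sigma>(2) along_restr by blast
  with less have "length (vals i (tree s \<rho>)) < length (vals i (tree s (\<rho> @ \<mu>)))"
    using length_vals_mono[of "restr X t" "tree s1 \<sigma>" i] eqs \<mu> by simp
  then have "progress ?k s (tree s \<rho>) < progress ?k s (tree s (\<rho> @ \<mu>))"
    using minds_mono[OF minds, of s] s(1) s1(1) by (intro progress_less tree_prefix) auto
  then have "acts s" by (simp add: acts_iff s(2))
  from acts_progress[OF this] eqs show False by (simp add: s(2))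
qed

lemma pi01_tree_class: "pi01_class tree_class"
proof -
  define bits where "bits c = map (\<lambda>v. (0::nat) < v) (list_decode c)" for c
  define R where "R c = (if \<exists>\<sigma>\<in>set (strs (length (bits c))). prefix (bits c) (tree (length (bits c)) \<sigma>)
    then 0 else (1::nat))" for c
  have "cmp R" unfolding R_def bits_def by (intro cmp_intros)
  then have "computable1 R" by (rule comp1_relI)
  moreover have bits: "bits (init_code X n) = restr X n" for X n
    by (simp add: init_code_def restr_def bits_def)
  have R: "R (init_code X n) = 0 \<longleftrightarrow> (\<exists>\<sigma>. length \<sigma> = n \<and> prefix (restr X n) (tree n \<sigma>))" for X n
    unfolding R_def bits length_restr set_strs by auto
  have "tree_class = {X. \<forall>n. R (init_code X n) = 0}"
    unfolding tree_class_def R ..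
  ultimately show ?thesis unfolding pi01_class_def by blast
qed

section \<open>The limit tree, nonemptiness and perfectness\<close>

definition lim_tree :: "bool list \<Rightarrow> bool list" where
  "lim_tree \<sigma> = tree (SOME s. settled s \<sigma>) \<sigma>"

lemma settled_lim_tree: 
  assumes "settled s \<sigma>" shows "tree s \<sigma> = lim_tree \<sigma>"
proof -
  let ?t = "SOME s. settled s \<sigma>"
  have "settled ?t \<sigma>" using assms by (rule someI)
  then have "tree (max s ?t) \<sigma> = tree ?t \<sigma>" by (rule settled_eq) simp
  moreover have "tree (max s ?t) \<sigma> = tree s \<sigma>" using assms by (rule settled_eq) simp
  ultimately show ?thesis by (simp add: lim_tree_def)
qed

lemma ex_settled_both: "\<exists>s. settled s \<sigma> \<and> settled s \<tau>"
  using ex_settled_finite[of "{\<sigma>, \<tau>}", OF _ ex_settled] by auto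

lemma lim_tree_prefix: "prefix \<sigma> \<tau> \<Longrightarrow> prefix (lim_tree \<sigma>) (lim_tree \<tau>)"
  using ex_settled_both[of \<sigma> \<tau>] settled_lim_tree tree_prefix by metis

lemma length_lim_tree: "length \<sigma> \<le> length (lim_tree \<sigma>)"
  unfolding lim_tree_def by (rule length_tree)

text \<open>The branch of the limit tree over Z. The node at level j + 1 has length greater than j,
  so it determines bit j.\<close>

definition path :: "nat set \<Rightarrow> nat set" where
  "path Z = {j. lim_tree (restr Z (Suc j)) ! j}"

lemma along_path: "along (path Z) (lim_tree (restr Z n))"
  unfolding along_def
proof (rule nth_equalityI)
  fix j assume j: "j < length (lim_tree (restr Z n))"
  let ?a = "lim_tree (restr Z n)" and ?b = "lim_tree (restr Z (Suc j))"
  have "prefix ?a ?b \<or> prefix ?b ?a"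
    using lim_tree_prefix prefix_restr nat_le_linear by metis
  moreover have "j < length ?b"
    using length_lim_tree[of "restr Z (Suc j)"] by simp
  ultimately have "?a ! j = ?b ! j"
    using j by (auto simp: prefix_def nth_append)
  then show "?a ! j = restr (path Z) (length ?a) ! j"
    using j by (simp add: path_def)
qed simp

lemma path_in_tree_class: "path Z \<in> tree_class"
  unfolding tree_class_def
proof (intro CollectI allI)
  fix s
  obtain t where t: "t \<ge> s" "\<And>\<sigma>. length \<sigma> = s \<Longrightarrow> settled t \<sigma>"
    using ex_settled_level[of s s] by blast
  \<comment> \<open>By nesting, the settled node occurs in the tree of stage \<open>s\<close> at
    level \<open>s\<close> or higher; cutting back to level \<open>s\<close> gives the witness that
    the class asks for.\<close>
  obtain \<sigma>' where \<sigma>': "tree t (restr Z s) = tree s \<sigma>'" "s \<le> length \<sigma>'"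
    using tree_later[OF t(1), of "restr Z s"] by auto
  have "tree s \<sigma>' = lim_tree (restr Z s)"
    using settled_lim_tree[OF t(2)] \<sigma>'(1) by simp
  then have "along (path Z) (tree s \<sigma>')" using along_path by simp
  then have "along (path Z) (tree s (take s \<sigma>'))"
    by (rule along_prefix) (intro tree_prefix take_is_prefix)
  moreover have len: "length (take s \<sigma>') = s" using \<sigma>'(2) by simp
  ultimately have "prefix (restr (path Z) s) (tree s (take s \<sigma>'))"
    using length_tree[of "take s \<sigma>'" s] by (intro along_prefix_iff[of "path Z"]) auto
  with len show "\<exists>\<sigma>. length \<sigma> = s \<and> prefix (restr (path Z) s) (tree s \<sigma>)" by blast
qed

text \<open>The two successors of \<rho> go to incomparable nodes of the limit tree.
  \<open>X\<close> passes through one of them; the branch over a set that begins with the other is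
  the second path.\<close>

lemma ex_other_path:
  assumes X: "X \<in> tree_class" and stab: "settled s0 \<rho>" and al: "along X (tree s0 \<rho>)"
  obtains Y where "Y \<in> tree_class" "Y \<noteq> X" "along Y (tree s0 \<rho>)"
proof -
  let ?k = "length \<rho>"
  obtain s where s: "s \<ge> s0" "\<And>\<sigma>. length \<sigma> = Suc ?k \<Longrightarrow> settled s \<sigma>"
    using ex_settled_level[of s0 "Suc ?k"] by blast
  obtain \<sigma> where \<sigma>: "length \<sigma> = Suc ?k" "along X (tree s \<sigma>)"
    using tree_class_along[OF X] by blast
  have \<rho>s: "tree s \<rho> = tree s0 \<rho>" using stab s(1) by (rule settled_eq)
  have "prefix \<rho> \<sigma>"
    using along_tree_prefix[of X s \<rho> \<sigma>] \<sigma> al \<rho>s by simp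
  then obtain zs where zs: "\<sigma> = \<rho> @ zs" by (auto simp: prefix_def)
  with \<sigma>(1) have "length zs = Suc 0" by simp
  then obtain c where c: "\<sigma> = \<rho> @ [c]" using zs by (auto simp: length_Suc_conv)
  let ?\<tau> = "\<rho> @ [\<not> c]" and ?Z = "{j. j \<le> length \<rho> \<and> (\<rho> @ [\<not> c]) ! j}"
  have Z: "restr ?Z (Suc ?k) = ?\<tau>"
    by (rule nth_equalityI) (auto simp: less_Suc_eq_le)
  have \<tau>: "along (path ?Z) (tree s ?\<tau>)"
    using along_path[of ?Z "Suc ?k"] settled_lim_tree[OF s(2), of ?\<tau>] by (simp add: Z)
  have "path ?Z \<noteq> X"
  proof
    assume "path ?Z = X"
    with \<tau> \<sigma> have "prefix ?\<tau> \<sigma>" by (intro along_tree_prefix[of X s]) auto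
    with c show False by simp
  qed
  moreover have "along (path ?Z) (tree s0 \<rho>)"
    using along_prefix[OF \<tau> tree_prefix[of \<rho>]] \<rho>s by simp
  ultimately show ?thesis using that path_in_tree_class by blast
qed

section \<open>Requirements that belong to actual functionals\<close>

lemma length_takeWhile_ge:
  assumes "k \<le> length xs" "\<And>j. j < k \<Longrightarrow> P (xs ! j)"
  shows "k \<le> length (takeWhile P xs)"
proof (rule ccontr)
  assume "\<not> ?thesis"
  then have less: "length (takeWhile P xs) < k" by simp
  with assms(1) nth_length_takeWhile[of P xs] have "\<not> P (xs ! length (takeWhile P xs))" by simp
  with assms(2)[OF less] show False by simp
qed

text \<open>Here \<open>b\<close> is the declared number of changes. The proof that no member is
  computable instantiates it with a bound that \<Gamma> may violate.\<close>

locale functional =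
  fixes X :: "nat set" and p q :: rf and \<Gamma> :: "nat \<Rightarrow> nat \<Rightarrow> nat" and b :: "nat \<Rightarrow> nat"
  assumes p: "ev X p [n, t] (\<Gamma> n t)" and q: "ev {} q [n] (b n)"
begin

definition req :: "nat \<Rightarrow> nat" where
  "req n = prod_encode (prod_encode (code p, code q), n)"

lemma outs_eq:
  "outs (req n) (restr X l) = map (\<lambda>t. Suc (\<Gamma> n t)) [0..<length (outs (req n) (restr X l))]"
proof (rule nth_equalityI)
  let ?xs = "map (\<lambda>t. interp (code p) [n, t] (restr X l)) [0..<l]"
  have o: "outs (req n) (restr X l) = takeWhile (\<lambda>v. 0 < v) ?xs"
    by (simp add: outs_def req_def)
  fix j assume j: "j < length (outs (req n) (restr X l))"
  then have "j < l"
    using length_takeWhile_le[of "\<lambda>v. 0 < v" ?xs] by (simp add: o)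
  moreover have "outs (req n) (restr X l) ! j = ?xs ! j"
    using j unfolding o by (rule takeWhile_nth)
  moreover have "0 < outs (req n) (restr X l) ! j"
    using nth_mem[OF j] set_takeWhileD[of _ "\<lambda>v. 0 < v" ?xs] unfolding o by blast
  ultimately have "outs (req n) (restr X l) ! j = Suc (\<Gamma> n j)"
    using interp_sound_total[OF p, of n j l] by simp
  then show "outs (req n) (restr X l) ! j
      = map (\<lambda>t. Suc (\<Gamma> n t)) [0..<length (outs (req n) (restr X l))] ! j"
    using j by simp
qed simp

lemma length_outs: "\<exists>l0. \<forall>l\<ge>l0. k \<le> length (outs (req n) (restr X l))"
proof -
  have "\<exists>l0. \<forall>l\<ge>l0. interp (code p) [n, t] (restr X l) = Suc (\<Gamma> n t)" for t
    by (rule interp_complete[OF p[of n t]]) blast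
  then have "\<exists>L. \<forall>t. \<forall>l\<ge>L t. interp (code p) [n, t] (restr X l) = Suc (\<Gamma> n t)"
    by (intro choice allI)
  then obtain L where L: "\<And>t l. l \<ge> L t \<Longrightarrow> interp (code p) [n, t] (restr X l) = Suc (\<Gamma> n t)"
    by blast
  have "k \<le> length (outs (req n) (restr X l))" if l: "l \<ge> k + (\<Sum>t<k. L t)" for l
  proof -
    have Lt: "L t \<le> l" if "t < k" for t
      using member_le_sum[of t "{..<k}" L] that l by simp
    have "k \<le> length (takeWhile (\<lambda>v. 0 < v) (map (\<lambda>t. interp (code p) [n, t] (restr X l)) [0..<l]))"
      using l by (intro length_takeWhile_ge) (simp_all add: L[OF Lt])
    then show ?thesis by (simp add: outs_def req_def)
  qed
  then show ?thesis by blast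
qed

lemma bval_eventually: "\<exists>l0. \<forall>l\<ge>l0. bval (req n) l = Suc (b n)"
proof -
  obtain l0 where "\<And>l. l \<ge> l0 \<Longrightarrow> interp (code q) [n] (restr {} l) = Suc (b n)"
    using interp_complete[OF q] by blast
  then show ?thesis
    by (intro exI[of _ l0]) (simp add: bval_def req_def restr_empty)
qed

lemma ex_awake: "\<exists>s. awake (req n) s"
proof -
  obtain l0 where "\<forall>l\<ge>l0. bval (req n) l = Suc (b n)" using bval_eventually by blast
  then have "awake (req n) (req n + Suc (b n) + l0)" by (simp add: awake_def)
  then show ?thesis by blast
qed

lemma minds_level:
  assumes "prod_encode (code p, code q) \<le> n" "awake (req n) s"
  shows "minds n s (req n)"
proof -
  obtain u where "u \<le> s" "first_awake (req n) u" using ex_first_awake[OF assms(2)] by blast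
  then show ?thesis
    using assms(1) unfolding minds_def less_Suc_eq_le
    by (intro exI[of _ "prod_encode (code p, code q)"] exI[of _ u] conjI)
      (simp_all add: req_def first_awake_def)
qed

end

text \<open>A program that is correct for the empty oracle becomes independent of the oracle by
  searching for a string of zeros on which the interpreter halts.\<close>

lemma cmp_computable1:
  assumes "computable1 f" shows "cmp f"
proof -
  obtain p where p: "\<And>x. ev {} p [x] (f x)" using assms by (auto simp: comp1_rel_def)
  let ?s = "\<lambda>x. LEAST s. 0 < interp (code p) [x] (replicate s False)"
  have ex: "\<exists>s. 0 < interp (code p) [x] (replicate s False)" for x
  proof -
    obtain l where "\<And>m. m \<ge> l \<Longrightarrow> interp (code p) [x] (restr {} m) = Suc (f x)"
      by (rule interp_complete[OF p[of x]]) blast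
    from this[of l] show ?thesis unfolding restr_empty by (intro exI[of _ l]) simp
  qed
  have "cmp (\<lambda>x. interp (code p) [x] (replicate (?s x) False) - 1)"
    by (intro cmp_intros ex)
  moreover have "interp (code p) [x] (replicate (?s x) False) - 1 = f x" for x
    using interp_sound_total[OF p[of x], of "?s x"] LeastI_ex[OF ex[of x]]
    unfolding restr_empty by simp
  ultimately show ?thesis by simp
qed

section \<open>No computable members\<close>

definition deviation :: "nat set \<Rightarrow> nat set \<Rightarrow> nat \<Rightarrow> nat \<Rightarrow> nat" where
  "deviation X Y n t = (case t of 0 \<Rightarrow> 0 | Suc j \<Rightarrow> if (j \<in> Y) = (j \<in> X) then 0 else 1)"

lemma ex_deviation_functional:
  assumes "computable_set X"
  obtains p q where "\<And>Y. functional Y p q (deviation X Y) (\<lambda>_. 1)"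
proof -
  from assms have \<chi>: "cmp (\<lambda>n. if n \<in> X then 1 else (0::nat))"
    unfolding computable_set_def by (rule cmp_computable1)
  have "cmp (\<lambda>a. if fst a = (if snd a \<in> X then 1 else (0::nat)) then 0 else (1::nat))"
    by (intro cmp_intros cmp_comp[OF \<chi>])
  then obtain d where
    d: "\<And>A a. ev A d [enc a] (enc (if fst a = (if snd a \<in> X then 1 else (0::nat)) then 0 else (1::nat)))"
    unfolding cmp_def by blast
  let ?G = "Comp d [Comp pair_rf [Comp Orc [Proj 1], Proj 1]]"
  have G: "ev Y ?G [y, t] (if (t \<in> Y) = (t \<in> X) then 0 else 1)" for Y y t
  proof -
    have 1: "ev Y (Proj 1) [y, t] t" by (rule ev_Proj_nth) auto
    have "ev Y d [prod_encode (if t \<in> Y then 1 else 0, t)] (if (t \<in> Y) = (t \<in> X) then 0 else 1)"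
      using d[of Y "(if t \<in> Y then 1 else 0, t)"]
      by (cases "t \<in> Y"; cases "t \<in> X") (simp_all add: enc_prod_def enc_nat_def)
    then show ?thesis
      by (rule ev_Comp1[OF ev_Comp2[OF ev_Comp1[OF 1 ev_Orc] 1 ev_pair]])
  qed
  let ?p = "Comp (Prec Zero ?G) [Proj 1]" and ?q = "const_rf 1"
  have prec: "ev Y (Prec Zero ?G) [t] (deviation X Y n t)" for Y n t
  proof (induction t)
    case 0
    show ?case by (auto intro: ev_Prec0 ev_Zero simp: deviation_def)
  next
    case (Suc t)
    show ?case using ev_PrecS[OF Suc G] by (simp add: deviation_def)
  qed
  have fn: "functional Y ?p ?q (deviation X Y) (\<lambda>_. 1)" for Y
  proof
    show "ev Y ?p [n, t] (deviation X Y n t)" for n t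
      by (rule ev_Comp1[OF _ prec]) (rule ev_Proj_nth, auto)
    show "ev {} ?q [n] 1" for n by (rule ev_const)
  qed
  then show ?thesis by (rule that)
qed

lemma not_computable:
  assumes X: "X \<in> tree_class" shows "\<not> computable_set X"
proof
  assume "computable_set X"
  then obtain p q where fn: "\<And>Y. functional Y p q (deviation X Y) (\<lambda>_. 1)"
    using ex_deviation_functional by blast
  interpret X: functional X p q "deviation X X" "\<lambda>_. 1" by (rule fn)
  let ?e = "prod_encode (code p, code q)"
  \<comment> \<open>The argument is the index itself, so that the condition e \<le> n of
    \<open>minds_level\<close> holds. The requirement depends only on the two programs, hence it is
    the same one for \<open>Y\<close> below.\<close>
  let ?i = "X.req ?e"
  obtain s0 where s0: "awake ?i s0" using X.ex_awake by blast
  obtain s where s: "s \<ge> s0" "\<And>\<sigma>. length \<sigma> = ?e \<Longrightarrow> settled s \<sigma>"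
    using ex_settled_level[of s0 ?e] by blast
  obtain \<rho> where \<rho>: "length \<rho> = ?e" "along X (tree s \<rho>)"
    using tree_class_along[OF X] by blast
  have stab: "settled s \<rho>" using s(2) \<rho>(1) by blast
  have minds: "minds (length \<rho>) s ?i"
    unfolding \<rho>(1) by (rule X.minds_level[OF order_refl awake_mono[OF s0 s(1)]])
  obtain Y where Y: "Y \<in> tree_class" "Y \<noteq> X" "along Y (tree s \<rho>)"
    using ex_other_path[OF X stab \<rho>(2)] by blast
  interpret Y: functional Y p q "deviation X Y" "\<lambda>_. 1" by (rule fn)
  have "length (vals ?i (tree s \<rho>)) \<le> 1"
  proof -
    obtain l where l: "tree s \<rho> = restr X l" using \<rho>(2) by (auto simp: along_def)
    have zero: "deviation X X n t = 0" for n t by (simp add: deviation_def split: nat.split)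
    obtain N where "outs ?i (restr X l) = replicate N (Suc 0)"
      using X.outs_eq[of ?e l] unfolding zero map_replicate_const by blast
    then have "length (remdups_adj (outs ?i (restr X l))) \<le> 1"
      by (simp add: remdups_adj_replicate)
    then show ?thesis by (simp add: l vals_def)
  qed
  moreover obtain l where "2 \<le> length (vals ?i (restr Y l))"
  proof -
    obtain j where j: "(j \<in> Y) \<noteq> (j \<in> X)" using Y(2) by blast
    obtain l1 where l1: "\<forall>l\<ge>l1. j + 2 \<le> length (outs ?i (restr Y l))"
      using Y.length_outs by blast
    obtain l2 where l2: "\<forall>l\<ge>l2. bval ?i l = Suc 1"
      using Y.bval_eventually by blast
    let ?l = "max l1 l2"
    let ?o = "outs ?i (restr Y ?l)"
    have len: "j + 2 \<le> length ?o" using l1[rule_format, of ?l] by simp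
    \<comment> \<open>The output at 0 is 0 by definition of \<open>deviation\<close>, and the
      disagreement at \<open>j\<close> shows at argument j + 1. The forced 0 yields a second value
      even if the sets already differ at 0.\<close>
    have "{Suc 0, Suc 1} \<subseteq> set ?o"
    proof -
      have mem: "Suc (deviation X Y ?e t) \<in> set ?o" if t: "t < length ?o" for t
      proof -
        have "?o ! t = map (\<lambda>t. Suc (deviation X Y ?e t)) [0..<length ?o] ! t"
          by (rule arg_cong[OF Y.outs_eq])
        also have "\<dots> = Suc (deviation X Y ?e t)" using t by simp
        finally show ?thesis using nth_mem[OF t] by simp
      qed
      have "0 < length ?o" "Suc j < length ?o" using len by linarith+
      from this[THEN mem] show ?thesis using j by (simp add: deviation_def)
    qed
    then have "{Suc 0, Suc 1} \<subseteq> set (remdups_adj ?o)" by simp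
    then have "card {Suc 0, Suc 1} \<le> card (set (remdups_adj ?o))"
      by (rule card_mono[OF finite_set])
    also have "\<dots> \<le> length (remdups_adj ?o)" by (rule card_length)
    finally have "2 \<le> length (remdups_adj ?o)" by simp
    \<comment> \<open>The declared bound 1 leaves room for two values, just enough to tell
      \<open>Y\<close> from \<open>X\<close>.\<close>
    moreover have "vals ?i (restr Y ?l) = take 2 (remdups_adj ?o)"
      using l2[rule_format, of ?l] by (simp add: vals_def numeral_2_eq_2)
    ultimately have "2 \<le> length (vals ?i (restr Y ?l))" by simp
    then show ?thesis by (rule that)
  qed
  ultimately show False
    using vals_maximal[OF Y(1) stab minds Y(3), of l] by simp
qed

section \<open>Bounding the number of changes\<close>

text \<open>Digit 0 is the leading one, because low levels have priority.\<close>

fun digits_val :: "nat \<Rightarrow> (nat \<Rightarrow> nat) \<Rightarrow> nat \<Rightarrow> nat" where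
  "digits_val Q a 0 = a 0"
| "digits_val Q a (Suc n) = Q * digits_val Q a n + a (Suc n)"

lemma digits_val_mono: "(\<And>j. j \<le> n \<Longrightarrow> a j \<le> b j) \<Longrightarrow> digits_val Q a n \<le> digits_val Q b n"
  by (induction n) (auto intro!: add_mono mult_le_mono2)

text \<open>Lexicographic comparison: a lead of one is worth Q at the next place, more than any
  digit of \<open>a\<close> there, so it survives whatever happens to the later digits.\<close>

lemma digits_val_less:
  assumes "m \<le> n" "\<And>j. j < m \<Longrightarrow> a j \<le> b j" "a m < b m" "\<And>j. j \<le> n \<Longrightarrow> a j < Q"
  shows "digits_val Q a n < digits_val Q b n"
  using assms(1,4)
proof (induction n)
  case 0
  then show ?case using assms(3) by simp
next
  case (Suc n)
  show ?case
  proof (cases "m = Suc n")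
    case True
    then have "digits_val Q a n \<le> digits_val Q b n"
      using assms(2) by (intro digits_val_mono) auto
    then show ?thesis using assms(3) True by (auto intro: add_le_less_mono)
  next
    case False
    then have "Suc (digits_val Q a n) \<le> digits_val Q b n" using Suc by simp
    then have "Q * Suc (digits_val Q a n) \<le> Q * digits_val Q b n" by (rule mult_le_mono2)
    moreover have "a (Suc n) < Q" using Suc.prems by simp
    ultimately show ?thesis by simp
  qed
qed

lemma digits_val_bound: "(\<And>j. j \<le> n \<Longrightarrow> a j < Q) \<Longrightarrow> digits_val Q a n < Q ^ Suc n"
proof (induction n)
  case (Suc n)
  then have "Suc (digits_val Q a n) \<le> Q ^ Suc n" "a (Suc n) < Q" by auto
  then have "Q * Suc (digits_val Q a n) \<le> Q * Q ^ Suc n" by (intro mult_le_mono2)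
  with \<open>a (Suc n) < Q\<close> show ?case by simp
qed simp

text \<open>V is injective on the stages of change from \<open>s0\<close> on, with values below N;
  the earlier stages are all counted as changes.\<close>

lemma card_changes:
  fixes V :: "nat \<Rightarrow> nat"
  assumes mono: "\<And>s. s \<ge> s0 \<Longrightarrow> V s \<le> V (Suc s)"
    and less: "\<And>s. s \<ge> s0 \<Longrightarrow> g (Suc s) \<noteq> g s \<Longrightarrow> V s < V (Suc s)"
    and bound: "\<And>s. s \<ge> s0 \<Longrightarrow> V s < N"
  shows "finite {s. g (Suc s) \<noteq> g s} \<and> card {s. g (Suc s) \<noteq> g s} \<le> s0 + N"
proof -
  let ?C = "{s. s \<ge> s0 \<and> g (Suc s) \<noteq> g s}"
  have V: "V s \<le> V t" if "s0 \<le> s" "s \<le> t" for s t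
    using that(2) that(1)
  proof (induction t rule: dec_induct)
    case (step t)
    then show ?case using mono[of t] by simp
  qed simp
  have "V s < V t" if "s \<in> ?C" "s < t" for s t
    using less[of s] V[of "Suc s" t] that by simp
  then have inj: "inj_on V ?C"
    by (intro inj_onI) (metis linorder_neqE_nat less_irrefl)
  have im: "V ` ?C \<subseteq> {..<N}" using bound by auto
  have fin: "finite ?C" using inj im by (meson finite_imageD finite_lessThan finite_subset)
  have card: "card ?C \<le> N"
    using card_mono[OF _ im] card_image[OF inj] by simp
  have sub: "{s. g (Suc s) \<noteq> g s} \<subseteq> {..<s0} \<union> ?C" by auto
  have "card {s. g (Suc s) \<noteq> g s} \<le> card ({..<s0} \<union> ?C)"
    using fin sub by (intro card_mono) auto
  also have "\<dots> \<le> s0 + N" using card_Un_le[of "{..<s0}" ?C] card by simp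
  finally show ?thesis using fin sub finite_subset by blast
qed

section \<open>The trace\<close>

text \<open>The alternative \<open>m = n\<close> makes the search total, hence computable, and keeps
  the result at most n.\<close>

definition home :: "nat \<Rightarrow> nat \<Rightarrow> nat \<Rightarrow> nat" where
  "home n i s = (LEAST m. m = n \<or> minds m s i)"

text \<open>The subtraction undoes the \<open>Suc\<close> by which the interpreter marks
  convergence; an empty list yields the default 0.\<close>

definition final :: "nat list \<Rightarrow> nat" where
  "final vs = (case rev vs of [] \<Rightarrow> 0 | v # _ \<Rightarrow> v - 1)"

definition trace :: "nat \<Rightarrow> nat \<Rightarrow> nat \<Rightarrow> nat list" where
  "trace n i s = map (\<lambda>\<rho>. final (vals i (tree s \<rho>))) (strs (home n i s))"

lemma cmp_trace [cmp_intros]: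
  assumes "cmp f" "cmp g" "cmp h" shows "cmp (\<lambda>x. trace (f x) (g x) (h x))"
proof -
  have "cmp (\<lambda>p. trace (fst p) (fst (snd p)) (snd (snd p)))"
    unfolding trace_def home_def final_def by (intro cmp_intros) blast+
  from cmp_comp[OF this, of "\<lambda>x. (f x, g x, h x)"] show ?thesis
    by (simp add: assms cmp_Pair)
qed

lemma home_le: "home n i s \<le> n"
  unfolding home_def by (rule Least_le) simp

lemma not_minds_below_home: "m < home n i s \<Longrightarrow> \<not> minds m s i"
  unfolding home_def by (metis (mono_tags, lifting) not_less_Least)

lemma minds_home: 
  assumes "minds n s i" shows "minds (home n i s) s i"
proof -
  have "home n i s = n \<or> minds (home n i s) s i"
    unfolding home_def by (rule LeastI[of _ n]) simp
  then show ?thesis using assms by auto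
qed

lemma home_antimono: "minds n s i \<Longrightarrow> s \<le> t \<Longrightarrow> home n i t \<le> home n i s"
  using minds_home[of n s i] minds_mono[of _ s i t]
  by (subst home_def, intro Least_le) auto

text \<open>If level m does not mind i although i is awake since stage s0, then no requirement
  (e, m) with e \<le> m has awoken after stage s0.\<close>

lemma not_minds_const:
  assumes "awake i s0" "s0 \<le> s" "\<not> minds m s i"
  shows "minds m s = minds m s0"
proof (intro ext iffI)
  fix j assume "minds m s j"
  then obtain e u where eu: "e < Suc m" "u < Suc s" "first_awake (prod_encode (e, m)) u" "awake j u"
    unfolding minds_def by blast
  have "u < Suc s0"
  proof (rule ccontr)
    assume "\<not> u < Suc s0"
    then have "awake i u" using awake_mono[OF assms(1)] by simp
    with eu assms(3) show False unfolding minds_def by blast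
  qed
  with eu show "minds m s0 j" unfolding minds_def by blast
qed (use minds_mono assms(2) in blast)

lemma length_trace: "length (trace n i s) \<le> 2 ^ n"
  by (simp add: trace_def length_strs home_le)

lemma level_sum_less:
  fixes f g :: "bool list \<Rightarrow> nat"
  assumes "\<And>\<rho>. length \<rho> = m \<Longrightarrow> f \<rho> < g \<rho>"
  shows "(\<Sum>\<rho> | length \<rho> = m. f \<rho>) < (\<Sum>\<rho> | length \<rho> = m. g \<rho>)"
proof (rule sum_strict_mono[OF finite_level])
  show "{\<rho> :: bool list. length \<rho> = m} \<noteq> {}"
    using length_replicate[of m False] by blast
qed (simp add: assms)

lemma level_sum_le:
  fixes f :: "bool list \<Rightarrow> nat"
  assumes "\<And>\<rho>. length \<rho> = m \<Longrightarrow> f \<rho> \<le> c"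
  shows "(\<Sum>\<rho> | length \<rho> = m. f \<rho>) \<le> 2 ^ m * c"
proof -
  have "card {\<rho> :: bool list. length \<rho> = m} \<le> 2 ^ m"
    using card_length[of "strs m"] by (simp only: set_strs length_strs)
  moreover have "(\<Sum>\<rho> | length \<rho> = m. f \<rho>) \<le> card {\<rho> :: bool list. length \<rho> = m} * c"
    using sum_bounded_above[of "{\<rho> :: bool list. length \<rho> = m}" f c] assms by simp
  ultimately show ?thesis by (meson le_trans mult_le_mono1)
qed

locale awake_requirement =
  fixes e n i s0
  assumes e_le: "e \<le> n" and i: "i = prod_encode (e, n)" and awake: "awake i s0"
begin

definition B :: nat where "B = Suc s0 * s0"

text \<open>One more than the largest digit: at most 2^n nodes on a level, each contributing at most
  \<open>Suc B + B\<close>.\<close>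

definition Q :: nat where "Q = Suc (2 ^ n * (Suc B + B))"

abbreviation "k \<equiv> home n i"

text \<open>The digits of a potential in base Q. Activity on a level below the home of i increases the
  digit of this level, and so does a fall of the home to this level.\<close>

definition digit :: "nat \<Rightarrow> nat \<Rightarrow> nat" where
  "digit s m = (\<Sum>\<rho> | length \<rho> = m. if m < k s then progress m s0 (tree s \<rho>)
     else if m = k s then Suc B + length (vals i (tree s \<rho>)) else 0)"

lemma minds_n: "s0 \<le> s \<Longrightarrow> minds n s i"
proof -
  assume "s0 \<le> s"
  obtain u where u: "u \<le> s0" "first_awake i u" using ex_first_awake[OF awake] by blast
  then show ?thesis
    unfolding minds_def less_Suc_eq_le using \<open>s0 \<le> s\<close> e_le
    by (intro exI[of _ e] exI[of _ u] conjI) (simp_all add: i first_awake_def)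
qed

lemma home_Suc: "s0 \<le> s \<Longrightarrow> k (Suc s) \<le> k s"
  using home_antimono[OF minds_n] by simp

lemma progress_below: "s0 \<le> s \<Longrightarrow> m < k s \<Longrightarrow> progress m s \<tau> = progress m s0 \<tau>"
  by (intro progress_cong not_minds_const[OF awake] not_minds_below_home)

lemma progress_B: "progress m s0 \<tau> \<le> B"
  unfolding B_def by (rule progress_le) (rule minds_awake)

lemma length_vals_B: "length (vals i \<tau>) \<le> B"
  using length_vals_le[OF awake, of \<tau>] unfolding B_def by simp

lemma digit_less: "m \<le> n \<Longrightarrow> digit s m < Q"
proof -
  assume "m \<le> n"
  have "digit s m \<le> 2 ^ m * (Suc B + B)"
    unfolding digit_def
  proof (rule level_sum_le)
    fix \<rho> :: "bool list"
    show "(if m < k s then progress m s0 (tree s \<rho>)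
        else if m = k s then Suc B + length (vals i (tree s \<rho>)) else 0) \<le> Suc B + B"
      using progress_B[of m "tree s \<rho>"] length_vals_B[of "tree s \<rho>"] by simp
  qed
  also have "\<dots> \<le> 2 ^ n * (Suc B + B)"
    using \<open>m \<le> n\<close> by (intro mult_le_mono1 power_increasing) auto
  finally show ?thesis unfolding Q_def by simp
qed

lemma digit_same:
  assumes "s0 \<le> s" "m < k (Suc s)" "acts s \<Longrightarrow> m < length (fst (cand s))"
  shows "digit (Suc s) m = digit s m"
proof -
  have "tree (Suc s) \<rho> = tree s \<rho>" if "length \<rho> = m" for \<rho>
    using assms(3) that by (intro tree_Suc_same) auto
  moreover have "m < k s" using assms(2) home_Suc[OF assms(1)] by simp
  ultimately show ?thesis unfolding digit_def using assms(2) by (intro sum.cong) auto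
qed

lemma potential_step:
  assumes s: "s0 \<le> s"
  shows "digits_val Q (digit s) n \<le> digits_val Q (digit (Suc s)) n"
    and "trace n i (Suc s) \<noteq> trace n i s \<Longrightarrow>
      digits_val Q (digit s) n < digits_val Q (digit (Suc s)) n"
proof -
  let ?r = "length (fst (cand s))"
  let ?goal = "digits_val Q (digit s) n < digits_val Q (digit (Suc s)) n"
  note hS = home_Suc[OF s]
  \<comment> \<open>(A) is a move strictly below the new home, whether or not the home falls; (B1) a
    fall of the home without such a move; (B2) a constant home with a move at or above it, or with
    no move.\<close>
  consider (A) "acts s" "?r < k (Suc s)"
    | (B1) "acts s \<Longrightarrow> k (Suc s) \<le> ?r" "k (Suc s) < k s"
    | (B2) "acts s \<Longrightarrow> k (Suc s) \<le> ?r" "k (Suc s) = k s"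
    using hS by (meson le_neq_implies_less not_le)
  then have "?goal \<or> (digits_val Q (digit s) n \<le> digits_val Q (digit (Suc s)) n
     \<and> trace n i (Suc s) = trace n i s)"
  proof cases
    case A
    have r: "?r < k s" using A hS by simp
    \<comment> \<open>Below the home the level minds the same requirements as at \<open>s0\<close>,
      so the gain in progress at stage \<open>s\<close> is a gain in the digit, which is measured at
      \<open>s0\<close>.\<close>
    have less: "progress ?r s0 (tree s (fst (cand s))) < progress ?r s0 (tree (Suc s) (fst (cand s)))"
      using acts_progress[OF A(1)] progress_below[OF s r] by simp
    have "digit s ?r < digit (Suc s) ?r"
      unfolding digit_def
    proof (rule sum_strict_mono_ex1[OF finite_level])
      show "\<forall>\<rho>\<in>{\<rho>. length \<rho> = ?r}.
         (if ?r < k s then progress ?r s0 (tree s \<rho>)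
          else if ?r = k s then Suc B + length (vals i (tree s \<rho>)) else 0)
         \<le> (if ?r < k (Suc s) then progress ?r s0 (tree (Suc s) \<rho>)
          else if ?r = k (Suc s) then Suc B + length (vals i (tree (Suc s) \<rho>)) else 0)"
        using r A(2) by (auto intro!: progress_mono tree_Suc_prefix)
      show "\<exists>\<rho>\<in>{\<rho>. length \<rho> = ?r}.
         (if ?r < k s then progress ?r s0 (tree s \<rho>)
          else if ?r = k s then Suc B + length (vals i (tree s \<rho>)) else 0)
         < (if ?r < k (Suc s) then progress ?r s0 (tree (Suc s) \<rho>)
          else if ?r = k (Suc s) then Suc B + length (vals i (tree (Suc s) \<rho>)) else 0)"
        using r A(2) less by (intro bexI[of _ "fst (cand s)"]) auto
    qed
    moreover have "digit s j \<le> digit (Suc s) j" if "j < ?r" for j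
      using digit_same[OF s, of j] that A(2) by simp
    moreover have "?r \<le> n" using r home_le[of n i s] by simp
    ultimately have ?goal using digit_less by (intro digits_val_less) auto
    then show ?thesis ..
  next
    case B1
    \<comment> \<open>The offset \<open>Suc B\<close> serves here: before the fall each node of this
      level contributed at most \<open>B\<close>, afterwards at least \<open>Suc B\<close>.\<close>
    have "digit s (k (Suc s)) < digit (Suc s) (k (Suc s))"
      unfolding digit_def
      by (rule level_sum_less) (use B1(2) progress_B in \<open>auto simp: less_Suc_eq_le intro: trans_le_add1\<close>)
    moreover have "digit s j \<le> digit (Suc s) j" if "j < k (Suc s)" for j
      using digit_same[OF s that] that B1(1) by fastforce
    ultimately have ?goal using digit_less home_le by (intro digits_val_less) auto
    then show ?thesis ..
  next
    case B2
    have below: "digit s j \<le> digit (Suc s) j" if "j < k s" for j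
      using digit_same[OF s, of j] that B2 by fastforce
    have pre: "prefix (vals i (tree s \<rho>)) (vals i (tree (Suc s) \<rho>))" if "length \<rho> = k s" for \<rho>
      using that B2 by (intro prefix_vals tree_Suc_prefix) auto
    have home: "digit s (k s) = (\<Sum>\<rho> | length \<rho> = k s. Suc B + length (vals i (tree s \<rho>)))"
      "digit (Suc s) (k s) = (\<Sum>\<rho> | length \<rho> = k s. Suc B + length (vals i (tree (Suc s) \<rho>)))"
      unfolding digit_def using B2(2) by simp_all
    have at: "digit s (k s) \<le> digit (Suc s) (k s)"
      unfolding home by (intro sum_mono add_left_mono prefix_length_le pre) simp
    have above: "digit s j \<le> digit (Suc s) j" if "j > k s" for j
      using that unfolding digit_def by simp
    have "digits_val Q (digit s) n \<le> digits_val Q (digit (Suc s)) n"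
      by (rule digits_val_mono) (metis below at above linorder_neqE_nat)
    moreover have ?goal if changed: "trace n i (Suc s) \<noteq> trace n i s"
    proof -
      obtain \<rho> where \<rho>: "length \<rho> = k s"
        "final (vals i (tree (Suc s) \<rho>)) \<noteq> final (vals i (tree s \<rho>))"
        using changed unfolding trace_def B2(2) map_eq_conv set_strs by blast
      \<comment> \<open>At the home the lists of values only grow by extension, so a changed last
        value means a longer list.\<close>
      then have "length (vals i (tree s \<rho>)) < length (vals i (tree (Suc s) \<rho>))"
        using pre[OF \<rho>(1)] by (metis nat_neq_iff not_equal_is_parallel prefix_length_le not_le parallelD1)
      then have "digit s (k s) < digit (Suc s) (k s)"
        unfolding home
        by (intro sum_strict_mono_ex1[OF finite_level])
          (auto intro!: prefix_length_le pre exI[of _ \<rho>] simp: \<rho>(1))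
      then show ?goal
        using below digit_less home_le by (intro digits_val_less[of "k s"]) auto
    qed
    ultimately show ?thesis by blast
  qed
  then show "digits_val Q (digit s) n \<le> digits_val Q (digit (Suc s)) n"
    and "trace n i (Suc s) \<noteq> trace n i s \<Longrightarrow> ?goal"
    by auto
qed

lemma trace_changes:
  "finite {s. trace n i (Suc s) \<noteq> trace n i s}
    \<and> card {s. trace n i (Suc s) \<noteq> trace n i s} \<le> s0 + Q ^ Suc n"
  by (rule card_changes[where V = "\<lambda>s. digits_val Q (digit s) n"],
      erule potential_step, erule potential_step, assumption,
      rule digits_val_bound, erule digit_less)

end

section \<open>The trace contains the limit and is a BLR trace\<close>

lemma length_remdups_adj_map:
  "length (remdups_adj (map g [0..<Suc k])) = Suc (card {t. t < k \<and> g (Suc t) \<noteq> g t})"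
proof (induction k)
  case (Suc k)
  have "map g [0..<Suc (Suc k)] = map g [0..<k] @ [g k, g (Suc k)]" by simp
  then have "remdups_adj (map g [0..<Suc (Suc k)]) =
      remdups_adj (map g [0..<Suc k]) @ (if g k = g (Suc k) then [] else [g (Suc k)])"
    by (simp add: remdups_adj_append_two)
  moreover have "{t. t < Suc k \<and> g (Suc t) \<noteq> g t} =
      (if g k = g (Suc k) then {t. t < k \<and> g (Suc t) \<noteq> g t}
       else insert k {t. t < k \<and> g (Suc t) \<noteq> g t})"
    by (auto simp: less_Suc_eq)
  ultimately show ?case using Suc by simp
qed simp

lemma final_eq: "vs \<noteq> [] \<Longrightarrow> final vs = last vs - 1"
  by (cases vs rule: rev_cases) (auto simp: final_def)

text \<open>A long segment shows the approximations up to an argument where the limit has been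
  reached. By the bound on the changes their merged list has at most b n + 1 entries, so nothing is
  cut off and its last entry comes from the limit.\<close>

lemma (in functional) vals_eventually:
  assumes "limit_bounded_changes \<Gamma> f b"
  shows "\<exists>l0. \<forall>l\<ge>l0. final (vals (req n) (restr X l)) = f n"
proof -
  obtain T where T: "\<forall>t\<ge>T. \<Gamma> n t = f n"
    using assms unfolding limit_bounded_changes_def by blast
  have fin: "finite {t. \<Gamma> n (Suc t) \<noteq> \<Gamma> n t}" and card: "card {t. \<Gamma> n (Suc t) \<noteq> \<Gamma> n t} \<le> b n"
    using assms unfolding limit_bounded_changes_def by blast+
  obtain l1 where l1: "\<forall>l\<ge>l1. Suc T \<le> length (outs (req n) (restr X l))"
    using length_outs by blast
  obtain l2 where l2: "\<forall>l\<ge>l2. bval (req n) l = Suc (b n)"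
    using bval_eventually by blast
  have "final (vals (req n) (restr X l)) = f n" if l: "l \<ge> max l1 l2" for l
  proof -
    let ?o = "outs (req n) (restr X l)"
    have "Suc T \<le> length ?o" using l1 l by simp
    then obtain k where k: "length ?o = Suc k" "T \<le> k" by (cases "length ?o") auto
    have o: "?o = map (\<lambda>t. Suc (\<Gamma> n t)) [0..<Suc k]"
      using outs_eq[of n l] unfolding k(1) .
    have "length (remdups_adj ?o) = Suc (card {t. t < k \<and> \<Gamma> n (Suc t) \<noteq> \<Gamma> n t})"
      unfolding o length_remdups_adj_map by simp
    also have "\<dots> \<le> Suc (b n)"
      using le_trans[OF card_mono[OF fin] card] by (simp add: Collect_mono)
    also have "Suc (b n) = bval (req n) l"
      using l2 l by simp
    finally have v: "vals (req n) (restr X l) = remdups_adj ?o"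
      by (simp add: vals_def)
    have "last ?o = Suc (f n)" using T k(2) unfolding o by simp
    moreover have "?o \<noteq> []" unfolding o by simp
    ultimately show ?thesis
      unfolding v by (simp add: final_eq)
  qed
  then show ?thesis by blast
qed

lemma finite_changes_convergent:
  fixes g :: "nat \<Rightarrow> 'a"
  assumes "finite {s. g (Suc s) \<noteq> g s}"
  shows "\<exists>s0. \<forall>s\<ge>s0. g s = g s0"
proof -
  obtain s0 where s0: "\<And>s. g (Suc s) \<noteq> g s \<Longrightarrow> s < s0"
    using assms unfolding finite_nat_set_iff_bounded by blast
  have "g s = g s0" if "s \<ge> s0" for s
    using that
  proof (induction s rule: dec_induct)
    case (step t)
    then show ?case using s0[of t] by (cases "g (Suc t) = g t") auto
  qed simp
  then show ?thesis by blast
qed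

lemma ex_settled_below: "\<exists>s\<ge>s0. \<forall>\<rho>. length \<rho> \<le> n \<longrightarrow> settled s \<rho>"
proof -
  have "{\<rho> :: bool list. length \<rho> \<le> n} = (\<Union>k\<le>n. {\<rho>. length \<rho> = k})" by auto
  then have "finite {\<rho> :: bool list. length \<rho> \<le> n}" using finite_level by simp
  from ex_settled_finite[OF this ex_settled]
  obtain s where s: "\<And>\<rho>. length \<rho> \<le> n \<Longrightarrow> settled s \<rho>" by blast
  show ?thesis by (rule exI[of _ "max s s0"]) (simp add: settled_mono[OF s])
qed

text \<open>\<open>X\<close> passes through a node of the home level, which minds the requirement.
  By maximality the values at this node agree with those of arbitrarily long segments of
  \<open>X\<close>, hence end with the limit.\<close>

lemma (in functional) limit_in_trace:
  assumes X: "X \<in> tree_class" and lim: "limit_bounded_changes \<Gamma> f b"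
    and minds: "minds n s (req n)" and stab: "\<And>\<rho>. length \<rho> \<le> n \<Longrightarrow> settled s \<rho>"
  shows "f n \<in> set (trace n (req n) s)"
proof -
  let ?k = "home n (req n) s"
  obtain \<rho> where \<rho>: "length \<rho> = ?k" "along X (tree s \<rho>)"
    using tree_class_along[OF X] by blast
  have m: "minds (length \<rho>) s (req n)" unfolding \<rho>(1) by (rule minds_home[OF minds])
  have st: "settled s \<rho>" by (rule stab) (simp add: \<rho>(1) home_le)
  obtain l0 where l0: "\<And>l. l \<ge> l0 \<Longrightarrow> final (vals (req n) (restr X l)) = f n"
    using vals_eventually[OF lim] by blast
  let ?l = "max l0 (length (tree s \<rho>))"
  have "prefix (tree s \<rho>) (restr X ?l)"
    using \<rho>(2) by (intro along_prefix_iff[of X]) auto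
  then have "prefix (vals (req n) (tree s \<rho>)) (vals (req n) (restr X ?l))" by (rule prefix_vals)
  with vals_maximal[OF X st m \<rho>(2), of ?l]
  have "vals (req n) (tree s \<rho>) = vals (req n) (restr X ?l)"
    by (auto simp: prefix_def)
  then have "final (vals (req n) (tree s \<rho>)) = f n" using l0[of ?l] by simp
  then show ?thesis
    using \<rho>(1) unfolding trace_def set_map set_strs by (intro image_eqI[of _ _ \<rho>]) auto
qed

lemma order_function_power2: "order_function (\<lambda>n. 2 ^ n)"
proof -
  have "cmp (\<lambda>n. 2 ^ n :: nat)" by (intro cmp_intros)
  then show ?thesis
    unfolding order_function_def
    by (auto intro: comp1_relI monoI power_increasing less_exp)
qed

lemma BLR_traceable_tree_class:
  assumes X: "X \<in> tree_class" shows "BLR_traceable X"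
proof -
  have "\<exists>T. BLR_trace T \<and> (\<forall>n. finite (T n) \<and> card (T n) \<le> 2 ^ n) \<and> (\<forall>n. f n \<in> T n)"
    if "omega_ce_by X f" for f
  proof -
    obtain \<Gamma> b p q where p: "\<And>n t. ev X p [n, t] (\<Gamma> n t)" and q: "\<And>n. ev {} q [n] (b n)"
      and lim: "limit_bounded_changes \<Gamma> f b"
      using \<open>omega_ce_by X f\<close> unfolding omega_ce_by_def comp1_rel_def comp2_rel_def by blast
    interpret functional X p q \<Gamma> b by unfold_locales (rule p, rule q)
    obtain idx :: "nat list \<Rightarrow> nat" where idx: "cmp idx" "\<And>v. W (idx v) = set v"
      using ex_W_index by blast
    define e where "e = prod_encode (code p, code q)"
    have req: "req n = prod_encode (e, n)" for n by (simp add: e_def req_def)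
    \<comment> \<open>These are the values at n < e, where \<open>minds_level\<close> does not
      apply. A finite list is a constant, so \<open>g\<close> remains computable.\<close>
    define fs where "fs = map f [0..<e]"
    define g where "g n s = (if n < e then idx [case drop n fs of [] \<Rightarrow> 0 | y # _ \<Rightarrow> y]
      else idx (trace n (prod_encode (e, n)) s))" for n s
    \<comment> \<open>The alternative \<open>n < e\<close> makes the search succeed for every n
      without recourse to the wake-up there.\<close>
    define s0 where "s0 n = (LEAST s. n < e \<or> awake (prod_encode (e, n)) s)" for n
    \<comment> \<open>This is the bound \<open>s0 + Q ^ Suc n\<close> of
      \<open>trace_changes\<close> written out, with \<open>s0\<close> as a function of n, so that
      it is visibly computable.\<close>
    define c where "c n = s0 n + Suc (2 ^ n * (Suc (Suc (s0 n) * s0 n) + Suc (s0 n) * s0 n)) ^ Suc n" for n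
    have ex: "\<exists>s. n < e \<or> awake (prod_encode (e, n)) s" for n
      using ex_awake[of n] unfolding req by blast
    have small: "g n s = idx [f n]" if "n < e" for n s
    proof -
      have "drop n fs = f n # drop (Suc n) fs"
        using that Cons_nth_drop_Suc[of n fs] by (simp add: fs_def)
      then show ?thesis using that by (simp add: g_def)
    qed
    have awake: "awake (req n) (s0 n)" if "\<not> n < e" for n
      using LeastI_ex[OF ex[of n]] that unfolding s0_def req by blast
    have changes: "finite {s. g n (Suc s) \<noteq> g n s} \<and> card {s. g n (Suc s) \<noteq> g n s} \<le> c n" for n
    proof (cases "n < e")
      case True
      then show ?thesis by (simp add: small)
    next
      case False
      interpret awake_requirement e n "req n" "s0 n"
        by unfold_locales (use False awake[OF False] in \<open>auto simp: req\<close>)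
      have sub: "{s. g n (Suc s) \<noteq> g n s} \<subseteq> {s. trace n (req n) (Suc s) \<noteq> trace n (req n) s}"
        using False by (auto simp: g_def req)
      have c: "c n = s0 n + Q ^ Suc n" unfolding c_def Q_def B_def ..
      show ?thesis
        using trace_changes card_mono[OF _ sub] finite_subset[OF sub] unfolding c by (meson le_trans)
    qed
    have "\<exists>r. \<forall>n. \<exists>s. \<forall>t\<ge>s. g n t = r n"
    proof (rule choice, rule allI)
      fix n
      obtain s where "\<forall>t\<ge>s. g n t = g n s"
        using finite_changes_convergent[of "g n"] changes by blast
      then show "\<exists>y. \<exists>s. \<forall>t\<ge>s. g n t = y" by blast
    qed
    then obtain r where r: "\<And>n. \<exists>s. \<forall>t\<ge>s. g n t = r n" by blast
    have W_r: "finite (W (r n)) \<and> card (W (r n)) \<le> 2 ^ n \<and> f n \<in> W (r n)" for n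
    proof -
      obtain s1 where s1: "\<And>t. t \<ge> s1 \<Longrightarrow> g n t = r n" using r[of n] by blast
      show ?thesis
      proof (cases "n < e")
        case True
        then have "W (r n) = {f n}" using s1[of s1] small[of n s1] idx(2)[of "[f n]"] by simp
        then show ?thesis by simp
      next
        case False
        obtain s where s: "s \<ge> max s1 (s0 n)" "\<And>\<rho>. length \<rho> \<le> n \<Longrightarrow> settled s \<rho>"
          using ex_settled_below[of "max s1 (s0 n)" n] by blast
        have "minds n s (req n)"
          using False awake_mono[OF awake[OF False], of s] s(1)
          by (intro minds_level) (simp_all add: e_def)
        then have "f n \<in> set (trace n (req n) s)" using s(2) by (rule limit_in_trace[OF X lim])
        moreover have "W (r n) = set (trace n (req n) s)"
          using s1[of s] s(1) False idx(2)[of "trace n (req n) s"] by (simp add: g_def req)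
        moreover have "card (set (trace n (req n) s)) \<le> 2 ^ n"
          using card_length length_trace le_trans by blast
        ultimately show ?thesis by simp
      qed
    qed
    have "computable2 g"
    proof (rule comp2_relI)
      show "cmp (\<lambda>p. g (fst p) (snd p))"
        unfolding g_def by (intro cmp_intros cmp_comp[OF idx(1)])
    qed
    moreover have "computable1 c"
      unfolding c_def s0_def by (intro comp1_relI cmp_intros ex)
    moreover have "limit_bounded_changes g r c"
      unfolding limit_bounded_changes_def using changes r by blast
    ultimately have "BLR_trace (\<lambda>n. W (r n))"
      unfolding BLR_trace_def by blast
    with W_r show ?thesis by (intro exI[of _ "\<lambda>n. W (r n)"]) blast
  qed
  with order_function_power2 show ?thesis
    unfolding BLR_traceable_def by blast
qed

theorem mainTheorem5:
  shows "\<exists>P. pi01_class P \<and> P \<noteq> {} \<and> (\<forall>X\<in>P. \<not> computable_set X) \<and> (\<forall>X\<in>P. BLR_traceable X)"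
proof (intro exI conjI ballI)
  show "pi01_class tree_class" by (rule pi01_tree_class)
  show "tree_class \<noteq> {}" using path_in_tree_class by blast
qed (rule not_computable BLR_traceable_tree_class, assumption)+

end
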